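(* Let $A$ be a real positive-semidefinite matrix of size $n\times n$. Given an integer $k$ with $1 \le k \le n$, let $U_1$ be an $n\times k$ matrix with orthonormal columns spanning a dominant $k$-dimensional invariant subspace of $A$, and let $\tau = \mu_0(U_1)$ denote the coherence of $U_1$. Fix a failure probability $\delta \in (0,1)$. For any $\varepsilon \in (0,1)$, if $\ell$ is an integer with $1\le \ell\le n$ and $$\ell \ge \frac{2\tau k \log\left(\frac{k}{\delta}\right)}{(1-\varepsilon)^2},$$ and $\ell$ columns of $A$ are chosen uniformly at random without replacement and used to form a Nyström extension $C W^\dagger C^t$, then $$\|A - C W^\dagger C^t\|_2 \le \lambda_{k+1}(A)\left(1 + \frac{n}{\varepsilon \ell}\right)$$ with probability exceeding $1-\delta$.
   Context: All matrices are real; $\|\cdot\|_2$ is the spectral norm, $(\cdot)^t$ the transpose, $(\cdot)^\dagger$ the Moore–Penrose pseudoinverse, and $\log$ the natural logarithm. The eigenvalues of a positive-semidefinite $A$ of size $n$ are ordered $\lambda_1(A) \ge \lambda_2(A) \ge \cdots \ge \lambda_n(A)$, counted with multiplicity; $\lambda_{n+1}(A)$ is interpreted as $0$. A dominant $k$-dimensional invariant subspace of $A$ is the span of $k$ orthonormal eigenvectors of $A$ with eigenvalues $\lambda_1(A), \dots, \lambda_k(A)$ (it need not be unique; any choice is allowed). The coherence of a matrix $U\in\mathbb{R}^{n\times k}$ with orthonormal columns is $\mu_0(U) = \frac{n}{k}\max_i (UU^t)_{ii}$, i.e. $\frac{n}{k}$ times the maximum squared Euclidean norm of a row of $U$. Nyström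 extension: given a choice of $\ell$ columns of $A$, $C$ is the $n\times \ell$ matrix consisting of these columns, and $W$ is the $\ell\times\ell$ principal submatrix of $A$ formed by the intersection of these columns with the corresponding rows. Equivalently, $C = AS$ and $W = S^tAS$, where, for uniform sampling without replacement, $S$ is distributed as the first $\ell$ columns of a uniformly random $n \times n$ permutation matrix. *)

theory Defs
  imports "HOL-Analysis.Analysis" "HOL-Probability.Probability"
    "HOL-Computational_Algebra.Polynomial"
begin

definition psd_matrix :: "real^'n^'n \<Rightarrow> bool" where
  "psd_matrix A \<longleftrightarrow> transpose A = A \<and> (\<forall>x. 0 \<le> x \<bullet> (A *v x))"

(* The class instance "norm" on matrices is the Frobenius norm, hence onorm. *)
definition spectral_norm :: "real^'n^'m \<Rightarrow> real" where
  "spectral_norm A = onorm ((*v) A)"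

definition charpoly :: "real^'n^'n \<Rightarrow> real poly" where
  "charpoly A = det (\<chi> i j. (if i = j then [:0, 1:] else 0) - [:A $ i $ j:])"

(* Eigenvalues are indexed from 1, in decreasing order, with (algebraic) multiplicity.
   A symmetric matrix of size n has n real roots of its characteristic polynomial, so there
   the index n + 1 gives 0. *)
definition eigenval :: "real^'n^'n \<Rightarrow> nat \<Rightarrow> real" where
  "eigenval A j =
    (let xs = rev (sorted_list_of_multiset (proots (charpoly A)))
     in if 1 \<le> j \<and> j \<le> length xs then xs ! (j - 1) else 0)"

definition dominant_invariant_subspace :: "real^'n^'n \<Rightarrow> nat \<Rightarrow> (real^'n) set \<Rightarrow> bool" where
  "dominant_invariant_subspace A k S \<longleftrightarrow>
    (\<exists>v :: nat \<Rightarrow> real^'n.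
       (\<forall>i\<in>{1..k}. \<forall>j\<in>{1..k}. v i \<bullet> v j = (if i = j then 1 else 0)) \<and>
       (\<forall>i\<in>{1..k}. A *v v i = eigenval A i *\<^sub>R v i) \<and>
       S = span (v ` {1..k}))"

definition orthonormal_columns :: "real^'k^'n \<Rightarrow> bool" where
  "orthonormal_columns U \<longleftrightarrow> transpose U ** U = mat 1"

definition coherence :: "real^'k^'n \<Rightarrow> real" where
  "coherence U = real CARD('n) / real CARD('k) * Max (range (\<lambda>i. (U ** transpose U) $ i $ i))"

(* The Moore-Penrose pseudoinverse, as the unique solution of the four Penrose equations. *)
definition pinv :: "real^'n^'m \<Rightarrow> real^'m^'n" where
  "pinv A = (THE X. A ** X ** A = A \<and> X ** A ** X = X \<and>
                    transpose (A ** X) = A ** X \<and> transpose (X ** A) = X ** A)"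

(* A choice of l columns, l = CARD('l), is an injective map from 'l to the column indices. *)
definition column_submatrix :: "real^'n^'n \<Rightarrow> ('l::finite \<Rightarrow> 'n) \<Rightarrow> real^'l^'n" where
  "column_submatrix A s = (\<chi> i j. A $ i $ s j)"

definition principal_submatrix :: "real^'n^'n \<Rightarrow> ('l::finite \<Rightarrow> 'n) \<Rightarrow> real^'l^'l" where
  "principal_submatrix A s = (\<chi> i j. A $ s i $ s j)"

definition nystrom :: "real^'n^'n \<Rightarrow> ('l::finite \<Rightarrow> 'n) \<Rightarrow> real^'n^'n" where
  "nystrom A s = column_submatrix A s ** pinv (principal_submatrix A s)
                   ** transpose (column_submatrix A s)"

(* A uniformly random injection has the law of the first l columns of a uniformly random
   permutation matrix. *)
definition uniform_without_replacement :: "('l::finite \<Rightarrow> 'n::finite) pmf" where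
  "uniform_without_replacement = pmf_of_set {s. inj s}"

end

theory Submission
  imports Defs
begin

text \<open>
  Write \<open>n\<close>, \<open>k\<close>, \<open>l\<close> for the sizes of the three index types and let \<open>u\<^sub>i\<close> be the rows of the matrix \<open>U\<close>
  of dominant eigenvectors. The argument has a deterministic and a probabilistic half, which meet in
  the smallest eigenvalue \<open>\<beta>\<close> of the sampled frame operator \<open>Y = \<Sum>\<^sub>j u\<^sub>s\<^sub>j u\<^sub>s\<^sub>j\<^sup>t\<close>.

  Deterministic half. The residual of the Nystrom extension is a Schur complement, so its quadratic
  form at \<open>x\<close> is at most that of \<open>A\<close> at \<open>x - S y\<close> for every \<open>y\<close> (\<open>nystrom_residual_form\<close>), where \<open>S\<close> selects
  the sampled columns. If \<open>\<beta> > 0\<close>, one can choose \<open>y\<close> with \<open>x - S y\<close> orthogonal to the dominant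
  subspace and of squared norm at most \<open>1 + 1/\<beta>\<close> times that of \<open>x\<close> (\<open>interpolation_from_sample\<close>). On the
  orthogonal complement the form of \<open>A\<close> is bounded by the next eigenvalue
  (\<open>dominant_complement_form_le\<close>). With \<open>\<beta> = \<epsilon> l / n\<close> this is the claimed error.

  Probabilistic half. It remains to show that \<open>Y\<close> has an eigenvalue below \<open>\<epsilon> l / n\<close> with probability
  smaller than \<open>\<delta>\<close>. The coherence bounds the rows by \<open>u\<^sub>i \<bullet> u\<^sub>i \<le> B\<close> with \<open>n B = \<tau> k\<close>, and the \<open>u\<^sub>i\<close> form a
  Parseval frame, so this is a matrix Chernoff bound for rank-one summands. Usually it rests on the
  matrix exponential and on Lieb's theorem or the Golden--Thompson inequality. Here the exponential
  \<open>exp (- \<theta> Y)\<close> is replaced by the power \<open>(C I - Y)\<^sup>N\<close> with \<open>C = N / \<theta>\<close>, and \<open>N\<close> tends to infinity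
  once only scalar quantities are left. For powers the necessary inequality for a rank-one update
  (\<open>optrace_rank_one_update_le\<close>) follows from Klein's inequality and Chebyshev's sum inequality in an
  eigenbasis. Averaged over the frame it bounds the expected trace for independent draws
  (\<open>sum_optrace_deficit_le\<close>). Since the trace of a power is convex, Hoeffding's argument transfers the
  bound to sampling without replacement (\<open>hoeffding_without_replacement\<close>). The strict inequality
  \<open>(1 - \<epsilon>)\<^sup>2 / 2 < 1 - \<epsilon> + \<epsilon> ln \<epsilon>\<close> finally gives a failure probability strictly below \<open>\<delta>\<close>.
\<close>

section \<open>Self-adjoint operators and the spectral theorem\<close>

definition selfadjoint :: "('a::euclidean_space \<Rightarrow> 'a) \<Rightarrow> bool" where
  "selfadjoint f \<longleftrightarrow> linear f \<and> (\<forall>x y. f x \<bullet> y = x \<bullet> f y)"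

definition psd_operator :: "('a::euclidean_space \<Rightarrow> 'a) \<Rightarrow> bool" where
  "psd_operator f \<longleftrightarrow> selfadjoint f \<and> (\<forall>x. 0 \<le> x \<bullet> f x)"

definition orthonormal :: "'a::euclidean_space set \<Rightarrow> bool" where
  "orthonormal B \<longleftrightarrow> pairwise orthogonal B \<and> (\<forall>b\<in>B. norm b = 1)"

text \<open>
  By \<open>optrace_orthonormal\<close> every orthonormal basis gives the same value.
\<close>

definition optrace :: "('a::euclidean_space \<Rightarrow> 'a) \<Rightarrow> real" where
  "optrace f = (\<Sum>b\<in>Basis. b \<bullet> f b)"

lemma discriminant_nonpos_of_quadratic_nonneg:
  fixes a b c :: real
  assumes "\<And>t. 0 \<le> a + 2 * t * b + t\<^sup>2 * c"
  shows "b\<^sup>2 \<le> a * c"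
proof (cases "c = 0")
  case True
  have "b = 0"
  proof (rule ccontr)
    assume "b \<noteq> 0"
    then have "2 * (-(a + 1) / (2 * b)) * b = -(a + 1)" by (simp add: field_simps)
    with assms[of "-(a + 1) / (2 * b)"] True show False by simp
  qed
  with True show ?thesis by simp
next
  case False
  have "0 \<le> c"
  proof (rule ccontr)
    assume "\<not> 0 \<le> c"
    hence c: "c < 0" by simp
    \<comment> \<open>Large enough that \<open>t \<ge> 1\<close> and \<open>t (-c) > \<bar>a\<bar>\<close>; the two signs of \<open>t\<close> cancel the linear term.\<close>
    define t where "t = (\<bar>a\<bar> + 1) / (- c) + 1"
    have "(\<bar>a\<bar> + 1) / (- c) > 0" using c by (intro divide_pos_pos) auto
    hence t: "t \<ge> 1" "t * (-c) \<ge> \<bar>a\<bar> + 1" unfolding t_def using c by (auto simp: field_simps)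
    have "t\<^sup>2 * (-c) \<ge> t * (-c)" using t c 
      by (intro mult_right_mono) (auto simp: power2_eq_square)
    hence "a + t\<^sup>2 * c < 0" using t by linarith
    moreover have "0 \<le> a + t\<^sup>2 * c"
      using assms[of t] assms[of "-t"] by simp
    ultimately show False by simp
  qed
  with False have c: "c > 0" by simp
  have "0 \<le> a + 2 * (-b/c) * b + (-b/c)\<^sup>2 * c" by (rule assms)
  also have "\<dots> = a - b\<^sup>2 / c" using c by (simp add: field_simps power2_eq_square)
  finally show ?thesis using c by (simp add: field_simps)
qed

text \<open>
  Cauchy--Schwarz for the semi-inner product \<open>x \<bullet> g y\<close>. Positivity is demanded on a subspace only,
  because in the proof of the spectral theorem it is known only on the invariant subspace at hand.
\<close>

lemma psd_operator_on_cauchy_schwarz: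
  fixes g :: "'a::euclidean_space \<Rightarrow> 'a"
  assumes g: "selfadjoint g" and W: "subspace W" 
    and pos: "\<And>z. z \<in> W \<Longrightarrow> 0 \<le> z \<bullet> g z" and x: "x \<in> W" and y: "y \<in> W"
  shows "(x \<bullet> g y)\<^sup>2 \<le> (x \<bullet> g x) * (y \<bullet> g y)"
proof (rule discriminant_nonpos_of_quadratic_nonneg)
  fix t :: real
  have lin: "linear g" and sa: "g u \<bullet> v = u \<bullet> g v" for u v 
    using g by (auto simp: selfadjoint_def)
  have "x + t *\<^sub>R y \<in> W" using W x y by (simp add: subspace_add subspace_scale)
  from pos[OF this] show "0 \<le> x \<bullet> g x + 2 * t * (x \<bullet> g y) + t\<^sup>2 * (y \<bullet> g y)"
    using sa[of x y] by (simp add: linear_add[OF lin] linear_scale[OF lin] inner_add inner_commute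
        power2_eq_square algebra_simps)
qed

lemma psd_operator_cauchy_schwarz:
  assumes "psd_operator g"
  shows "(x \<bullet> g y)\<^sup>2 \<le> (x \<bullet> g x) * (y \<bullet> g y)"
  using psd_operator_on_cauchy_schwarz[of g UNIV x y] assms by (auto simp: psd_operator_def)

lemma psd_operator_quadratic_form_zero:
  assumes "psd_operator g" and "x \<bullet> g x = 0"
  shows "g x = 0"
  using psd_operator_cauchy_schwarz[OF assms(1), of "g x" x] assms(2) by simp

text \<open>
  The Rayleigh quotient attains its maximum \<open>\<mu>\<close> on the unit sphere of \<open>W\<close>, by compactness. At a
  maximiser \<open>x\<close> the form of \<open>\<mu> - f\<close>, which is positive semidefinite on \<open>W\<close>, vanishes, so
  Cauchy--Schwarz makes \<open>x\<close> a null vector of \<open>\<mu> - f\<close>.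
\<close>

lemma selfadjoint_eigenvector:
  fixes f :: "'a::euclidean_space \<Rightarrow> 'a"
  assumes f: "selfadjoint f" and W: "subspace W" and inv: "f ` W \<subseteq> W" and ne: "W \<noteq> {0}"
  obtains x \<mu> where "x \<in> W" "norm x = 1" "f x = \<mu> *\<^sub>R x"
proof -
  have lin: "linear f" and sa: "f u \<bullet> v = u \<bullet> f v" for u v 
    using f by (auto simp: selfadjoint_def)
  define K where "K = sphere 0 1 \<inter> W"
  have "compact K" unfolding K_def by (intro compact_Int_closed compact_sphere closed_subspace W)
  moreover have "K \<noteq> {}"
  proof -
    obtain w where w: "w \<in> W" "w \<noteq> 0" using ne subspace_0[OF W] by blast
    hence "w /\<^sub>R norm w \<in> K" using subspace_scale[OF W] by (auto simp: K_def)
    thus ?thesis by blast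
  qed
  moreover have "continuous_on K (\<lambda>x. x \<bullet> f x)"
    by (intro continuous_intros linear_continuous_on linear_conv_bounded_linear[THEN iffD1] lin)
  ultimately obtain x where x: "x \<in> K" "\<And>y. y \<in> K \<Longrightarrow> y \<bullet> f y \<le> x \<bullet> f x"
    using continuous_attains_sup by metis
  define \<mu> where "\<mu> = x \<bullet> f x"
  define g where "g = (\<lambda>y. \<mu> *\<^sub>R y - f y)"
  have xW: "x \<in> W" and nx: "norm x = 1" using x by (auto simp: K_def)
  have g: "selfadjoint g" unfolding selfadjoint_def g_def
    by (auto intro!: linear_compose_sub lin linear_scale_self simp: inner_diff sa)
  have gpos: "0 \<le> z \<bullet> g z" if "z \<in> W" for z
  proof (cases "z = 0")
    case False
    have "z /\<^sub>R norm z \<in> K" using that False subspace_scale[OF W] by (auto simp: K_def)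
    from x(2)[OF this] have "(z \<bullet> f z) / (norm z)\<^sup>2 \<le> \<mu>"
      by (simp add: \<mu>_def linear_scale[OF lin] power2_eq_square field_simps)
    hence "z \<bullet> f z \<le> \<mu> * (norm z)\<^sup>2" using False by (simp add: field_simps)
    thus ?thesis by (simp add: g_def inner_diff_right dot_square_norm)
  qed (simp add: g_def)
  have gx: "g x \<in> W" unfolding g_def using xW inv W 
    by (auto intro!: subspace_diff subspace_scale)
  have "x \<bullet> g x = 0" using nx by (simp add: g_def inner_diff_right \<mu>_def dot_square_norm)
  with psd_operator_on_cauchy_schwarz[OF g W gpos gx xW] have "g x = 0" by simp
  hence "f x = \<mu> *\<^sub>R x" by (simp add: g_def)
  with xW nx that show thesis by blast
qed

text \<open>
  Induction on the dimension: split off one unit eigenvector; its orthogonal complement in \<open>W\<close> is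
  again invariant because \<open>f\<close> is self-adjoint. The version for invariant subspaces is what allows
  prescribed eigenvectors to be completed to an eigenbasis.
\<close>

theorem spectral_theorem_invariant_subspace:
  fixes f :: "'a::euclidean_space \<Rightarrow> 'a"
  assumes f: "selfadjoint f" and W: "subspace W" and inv: "f ` W \<subseteq> W"
  obtains B lam where "B \<subseteq> W" "finite B" "orthonormal B" "span B = W" "\<And>b. b \<in> B \<Longrightarrow> f b = lam b *\<^sub>R b"
proof -
  have sa: "f u \<bullet> v = u \<bullet> f v" for u v 
    using f by (auto simp: selfadjoint_def)
  have "\<exists>B. B \<subseteq> W \<and> finite B \<and> orthonormal B \<and> span B = W \<and> (\<forall>b\<in>B. \<exists>\<mu>. f b = \<mu> *\<^sub>R b)"
    using W inv
  proof (induction "dim W" arbitrary: W rule: less_induct)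
    case less
    show ?case
    proof (cases "W = {0}")
      case True
      thus ?thesis by (intro exI[of _ "{}"]) (auto simp: orthonormal_def)
    next
      case False
      then obtain x \<mu> where x: "x \<in> W" "norm x = 1" "f x = \<mu> *\<^sub>R x"
        using selfadjoint_eigenvector[OF f less.prems] by blast
      have xx: "x \<bullet> x = 1" using x by (simp add: dot_square_norm)
      define V where "V = {y \<in> W. x \<bullet> y = 0}"
      have V: "subspace V" unfolding V_def using less.prems(1)
        by (auto simp: subspace_def inner_add_right)
      have Vinv: "f ` V \<subseteq> V" using less.prems(2) x sa[of x, symmetric] by (auto simp: V_def)
      have "V \<subset> W"
      proof -
        have "x \<notin> V" using xx by (simp add: V_def)
        moreover have "V \<subseteq> W" by (auto simp: V_def)
        ultimately show ?thesis using x(1) by blast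
      qed
      hence "dim V < dim W" using V less.prems(1)
        by (metis dim_psubset psubset_eq span_eq_iff)
      from less.hyps[OF this V Vinv] obtain B where B: "B \<subseteq> V" "finite B" "orthonormal B" 
        "span B = V" "\<forall>b\<in>B. \<exists>\<mu>. f b = \<mu> *\<^sub>R b" by blast
      have "W \<subseteq> span (insert x B)"
      proof
        fix w assume w: "w \<in> W"
        have "w - (x \<bullet> w) *\<^sub>R x \<in> V" unfolding V_def using w x less.prems(1) xx
          by (auto intro!: subspace_diff subspace_scale simp: inner_diff_right)
        thus "w \<in> span (insert x B)" using B(4) by (auto simp: span_insert)
      qed
      moreover have "insert x B \<subseteq> W" using x B(1) by (auto simp: V_def)
      ultimately have "span (insert x B) = W" using less.prems(1) 
        by (metis span_eq_iff span_mono subset_antisym)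
      moreover have "orthonormal (insert x B)" using B(1,3) x(2)
        by (auto simp: orthonormal_def pairwise_insert orthogonal_def V_def inner_commute)
      ultimately show ?thesis using B x \<open>insert x B \<subseteq> W\<close>
        by (intro exI[of _ "insert x B"]) auto
    qed
  qed
  then obtain B where B: "B \<subseteq> W" "finite B" "orthonormal B" "span B = W" "\<forall>b\<in>B. \<exists>\<mu>. f b = \<mu> *\<^sub>R b"
    by blast
  from bchoice[OF B(5)] obtain lam where "\<forall>b\<in>B. f b = lam b *\<^sub>R b" by blast
  with B that show thesis by blast
qed

corollary spectral_theorem:
  fixes f :: "'a::euclidean_space \<Rightarrow> 'a"
  assumes "selfadjoint f"
  obtains B lam where "finite B" "orthonormal B" "span B = UNIV" "\<And>b. b \<in> B \<Longrightarrow> f b = lam b *\<^sub>R b"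
  using spectral_theorem_invariant_subspace[OF assms subspace_UNIV] by (metis subset_UNIV)

lemma orthonormal_expand:
  assumes "orthonormal B" "finite B" "span B = UNIV"
  shows "(\<Sum>b\<in>B. (x \<bullet> b) *\<^sub>R b) = x"
  using assms orthonormal_basis_expand[of B x] by (auto simp: orthonormal_def)

lemma orthonormal_inner:
  assumes "orthonormal B" "finite B" "span B = UNIV"
  shows "(\<Sum>b\<in>B. (x \<bullet> b) * (y \<bullet> b)) = x \<bullet> y"
proof -
  have "x \<bullet> y = (\<Sum>b\<in>B. (x \<bullet> b) *\<^sub>R b) \<bullet> y" by (simp add: orthonormal_expand[OF assms])
  thus ?thesis by (simp only: inner_sum_left inner_scaleR_left inner_commute[of y])
qed

lemma orthonormal_inner_self: "orthonormal B \<Longrightarrow> b \<in> B \<Longrightarrow> b \<bullet> b = 1"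
  by (simp add: orthonormal_def dot_square_norm)

lemma optrace_orthonormal:
  assumes lin: "linear f" and B: "orthonormal B" "finite B" "span B = UNIV"
  shows "optrace f = (\<Sum>b\<in>B. b \<bullet> f b)"
proof -
  have "b \<bullet> f b = (\<Sum>e\<in>B. \<Sum>e'\<in>B. (b \<bullet> e) * (b \<bullet> e') * (e' \<bullet> f e))" for b
  proof -
    have "b \<bullet> f b = b \<bullet> f (\<Sum>e\<in>B. (b \<bullet> e) *\<^sub>R e)" by (simp add: orthonormal_expand[OF B])
    also have "\<dots> = (\<Sum>e\<in>B. (b \<bullet> e) * (b \<bullet> f e))"
      by (simp add: linear_sum[OF lin] linear_scale[OF lin] inner_sum_right)
    also have "\<dots> = (\<Sum>e\<in>B. (b \<bullet> e) * (\<Sum>e'\<in>B. (b \<bullet> e') * (f e \<bullet> e')))"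
      by (simp only: orthonormal_inner[OF B])
    finally show ?thesis by (simp add: sum_distrib_left inner_commute mult.assoc)
  qed
  hence "optrace f = (\<Sum>b\<in>Basis. \<Sum>e\<in>B. \<Sum>e'\<in>B. (b \<bullet> e) * (b \<bullet> e') * (e' \<bullet> f e))"
    by (simp add: optrace_def)
  also have "\<dots> = (\<Sum>e\<in>B. \<Sum>b\<in>Basis. \<Sum>e'\<in>B. (b \<bullet> e) * (b \<bullet> e') * (e' \<bullet> f e))"
    by (rule sum.swap)
  also have "\<dots> = (\<Sum>e\<in>B. \<Sum>e'\<in>B. \<Sum>b\<in>Basis. (b \<bullet> e) * (b \<bullet> e') * (e' \<bullet> f e))"
    by (intro sum.cong refl sum.swap)
  also have "\<dots> = (\<Sum>e\<in>B. \<Sum>e'\<in>B. (e \<bullet> e') * (e' \<bullet> f e))"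
    by (simp add: sum_distrib_right[symmetric] inner_commute[of _ "_::'a"] euclidean_inner[symmetric])
  also have "\<dots> = (\<Sum>e\<in>B. \<Sum>e'\<in>B. (e \<bullet> e') * (f e \<bullet> e'))"
    by (simp add: inner_commute)
  also have "\<dots> = (\<Sum>e\<in>B. e \<bullet> f e)" by (simp add: orthonormal_inner[OF B])
  finally show ?thesis .
qed


section \<open>Powers and traces of positive semidefinite operators\<close>

lemma psd_operator_selfadjoint: "psd_operator f \<Longrightarrow> selfadjoint f" by (simp add: psd_operator_def)
lemma psd_operator_nonneg: "psd_operator f \<Longrightarrow> 0 \<le> x \<bullet> f x" by (simp add: psd_operator_def)
lemma selfadjoint_linear: "selfadjoint f \<Longrightarrow> linear f" by (simp add: selfadjoint_def)
lemma selfadjoint_inner: "selfadjoint f \<Longrightarrow> f x \<bullet> y = x \<bullet> f y" by (simp add: selfadjoint_def)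

lemma linear_funpow:
  fixes f :: "'a::real_vector \<Rightarrow> 'a"
  assumes "linear f" shows "linear (f ^^ n)"
proof (induction n)
  case (Suc n)
  thus ?case using linear_compose[OF Suc.IH assms] by (simp add: o_def)
qed (simp add: linear_id[unfolded id_def])

lemma selfadjoint_funpow:
  assumes "selfadjoint f" shows "selfadjoint (f ^^ n)"
proof -
  have "(f ^^ n) x \<bullet> y = x \<bullet> (f ^^ n) y" for x y
  proof (induction n arbitrary: x y)
    case (Suc n)
    thus ?case using assms by (simp add: selfadjoint_inner funpow_swap1)
  qed simp
  thus ?thesis using assms by (auto simp: selfadjoint_def linear_funpow)
qed

lemma funpow_eigenvector:
  assumes "linear f" "f b = e *\<^sub>R b"
  shows "(f ^^ n) b = e ^ n *\<^sub>R b"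
  by (induction n) (simp_all add: linear_scale[OF assms(1)] assms(2))

lemma inner_eigenbasis:
  assumes f: "selfadjoint f" and B: "orthonormal B" "finite B" "span B = UNIV" 
    and lam: "\<And>b. b \<in> B \<Longrightarrow> f b = lam b *\<^sub>R b"
  shows "x \<bullet> (f ^^ n) x = (\<Sum>b\<in>B. (x \<bullet> b)\<^sup>2 * lam b ^ n)"
proof -
  have "x \<bullet> (f ^^ n) x = (\<Sum>b\<in>B. (x \<bullet> b) * ((f ^^ n) x \<bullet> b))"
    by (rule orthonormal_inner[OF B, symmetric])
  also have "\<dots> = (\<Sum>b\<in>B. (x \<bullet> b)\<^sup>2 * lam b ^ n)"
    by (intro sum.cong refl) 
      (simp add: selfadjoint_inner[OF selfadjoint_funpow[OF f]]
        funpow_eigenvector[OF selfadjoint_linear[OF f] lam] power2_eq_square mult_ac)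
  finally show ?thesis .
qed

lemma eigenvalue_ge:
  assumes "\<And>x. c * (x \<bullet> x) \<le> x \<bullet> f x" "orthonormal B" "b \<in> B" "f b = e *\<^sub>R b"
  shows "c \<le> e"
  using assms(1)[of b] assms(4) orthonormal_inner_self[OF assms(2,3)] by simp

lemma psd_operator_eigenvalue:
  assumes "psd_operator f" "orthonormal B" "b \<in> B" "f b = e *\<^sub>R b"
  shows "0 \<le> e"
  using eigenvalue_ge[of 0 f, OF _ assms(2-4)] psd_operator_nonneg[OF assms(1)] by simp

lemma psd_operator_funpow:
  assumes "psd_operator f" shows "psd_operator (f ^^ n)"
proof -
  note f = psd_operator_selfadjoint[OF assms]
  obtain B lam where B: "finite B" "orthonormal B" "span B = UNIV" "\<And>b. b \<in> B \<Longrightarrow> f b = lam b *\<^sub>R b"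
    using spectral_theorem[OF f] by blast
  have "0 \<le> lam b" if "b \<in> B" for b 
    using psd_operator_eigenvalue[OF assms B(2) that B(4)[OF that]] .
  hence "0 \<le> x \<bullet> (f ^^ n) x" for x
    by (subst inner_eigenbasis[OF f B(2,1,3,4)]) (auto intro!: sum_nonneg)
  thus ?thesis using selfadjoint_funpow[OF f] by (simp add: psd_operator_def)
qed

text \<open>
  In an eigenbasis the moments \<open>x \<bullet> f\<^sup>j x\<close> are sums \<open>\<Sum> w\<^sub>b \<lambda>\<^sub>b\<^sup>j\<close> with nonnegative weights, and
  \<open>\<lambda>\<^sup>j\<close>, \<open>\<lambda>\<^sup>m\<close> are both increasing in \<open>\<lambda> \<ge> 0\<close>. So this is Chebyshev's sum inequality: sum
  \<open>(\<lambda>\<^sub>b\<^sup>j - \<lambda>\<^sub>c\<^sup>j) (\<lambda>\<^sub>b\<^sup>m - \<lambda>\<^sub>c\<^sup>m) \<ge> 0\<close> over all pairs.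
\<close>

lemma moment_product_le:
  assumes "psd_operator f"
  shows "(x \<bullet> (f ^^ j) x) * (x \<bullet> (f ^^ m) x) \<le> (x \<bullet> x) * (x \<bullet> (f ^^ (j + m)) x)"
proof -
  note f = psd_operator_selfadjoint[OF assms]
  obtain B lam where B: "finite B" "orthonormal B" "span B = UNIV" "\<And>b. b \<in> B \<Longrightarrow> f b = lam b *\<^sub>R b"
    using spectral_theorem[OF f] by blast
  have lam: "0 \<le> lam b" if "b \<in> B" for b 
    using psd_operator_eigenvalue[OF assms B(2) that B(4)[OF that]] .
  define w where "w = (\<lambda>b. (x \<bullet> b)\<^sup>2)"
  define a where "a = (\<lambda>j. \<Sum>b\<in>B. w b * lam b ^ j)"
  have a: "x \<bullet> (f ^^ j) x = a j" for j
    unfolding a_def w_def by (rule inner_eigenbasis[OF f B(2,1,3,4)])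
  have a0: "x \<bullet> x = a 0" using a[of 0] by simp
  have prod: "a i * a k = (\<Sum>b\<in>B. \<Sum>c\<in>B. w b * w c * (lam b ^ i * lam c ^ k))" for i k
    by (simp add: a_def sum_product mult.assoc mult.left_commute)
  have prod': "a i * a k = (\<Sum>b\<in>B. \<Sum>c\<in>B. w b * w c * (lam c ^ i * lam b ^ k))" for i k
    using prod[of k i] by (simp add: mult.commute)
  have "0 \<le> (\<Sum>b\<in>B. \<Sum>c\<in>B. w b * w c * ((lam b ^ j - lam c ^ j) * (lam b ^ m - lam c ^ m)))"
  proof (intro sum_nonneg)
    fix b c assume bc: "b \<in> B" "c \<in> B"
    have "0 \<le> (lam b ^ j - lam c ^ j) * (lam b ^ m - lam c ^ m)"
    proof (cases "lam b \<le> lam c")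
      case True
      thus ?thesis using lam bc by (intro mult_nonpos_nonpos) (auto intro!: power_mono)
    next
      case False
      thus ?thesis using lam bc by (intro mult_nonneg_nonneg) (auto intro!: power_mono)
    qed
    thus "0 \<le> w b * w c * ((lam b ^ j - lam c ^ j) * (lam b ^ m - lam c ^ m))"
      by (simp add: w_def)
  qed
  also have "\<dots> = a (j+m) * a 0 + a 0 * a (j+m) - a j * a m - a m * a j"
  proof -
    have "a j * a m + a m * a j + (\<Sum>b\<in>B. \<Sum>c\<in>B. w b * w c * ((lam b ^ j - lam c ^ j) * (lam b ^ m - lam c ^ m)))
       = (\<Sum>b\<in>B. \<Sum>c\<in>B. w b * w c * (lam b ^ j * lam c ^ m)) 
       + (\<Sum>b\<in>B. \<Sum>c\<in>B. w b * w c * (lam b ^ m * lam c ^ j)) 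
       + (\<Sum>b\<in>B. \<Sum>c\<in>B. w b * w c * ((lam b ^ j - lam c ^ j) * (lam b ^ m - lam c ^ m)))"
      by (simp only: prod)
    also have "\<dots> = (\<Sum>b\<in>B. \<Sum>c\<in>B. w b * w c * (lam b ^ (j+m) * lam c ^ 0))
                  + (\<Sum>b\<in>B. \<Sum>c\<in>B. w b * w c * (lam b ^ 0 * lam c ^ (j+m)))"
      unfolding sum.distrib[symmetric] by (intro sum.cong refl) (simp add: algebra_simps power_add)
    finally show ?thesis by (simp only: prod) 
  qed
  finally show ?thesis by (simp add: a a0 mult.commute)
qed

lemma power_tangent_le:
  fixes a b :: real
  assumes "0 \<le> a" "0 \<le> b"
  shows "b ^ Suc M + real (Suc M) * b ^ M * (a - b) \<le> a ^ Suc M"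
proof (induction M)
  case (Suc M)
  have "b ^ Suc (Suc M) + real (Suc (Suc M)) * b ^ Suc M * (a - b)
      = a * (b ^ Suc M + real (Suc M) * b ^ M * (a - b)) - real (Suc M) * b ^ M * (a - b)\<^sup>2"
    by (simp add: algebra_simps power2_eq_square)
  also have "\<dots> \<le> a * (b ^ Suc M + real (Suc M) * b ^ M * (a - b))"
    using assms by simp
  also have "\<dots> \<le> a * a ^ Suc M" using Suc assms by (intro mult_left_mono) auto
  finally show ?case by simp
qed simp

text \<open>
  Convexity of the map \<open>H \<mapsto> tr H\<^sup>M\<^sup>+\<^sup>1\<close>, in tangent form. With eigenbases \<open>e\<close> of \<open>H\<close> and \<open>f\<close> of \<open>K\<close>
  the two sides become sums over pairs \<open>(e, f)\<close> with the common weights \<open>(f \<bullet> e)\<^sup>2\<close>, and the claim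
  holds for every pair by \<open>power_tangent_le\<close>. It serves twice: for rank-one updates, and for the
  comparison of sampling with and without replacement.
\<close>

lemma klein_inequality:
  fixes H K :: "'a::euclidean_space \<Rightarrow> 'a"
  assumes H: "psd_operator H" and K: "psd_operator K"
  shows "optrace (K ^^ Suc M) + real (Suc M) * optrace (\<lambda>x. (K ^^ M) (H x - K x)) \<le> optrace (H ^^ Suc M)"
proof -
  note Hs = psd_operator_selfadjoint[OF H] and Ks = psd_operator_selfadjoint[OF K]
  note lH = selfadjoint_linear[OF Hs] and lK = selfadjoint_linear[OF Ks]
  obtain A a where A: "finite A" "orthonormal A" "span A = UNIV" "\<And>b. b \<in> A \<Longrightarrow> H b = a b *\<^sub>R b"
    using spectral_theorem[OF Hs] by blast
  obtain B b where B: "finite B" "orthonormal B" "span B = UNIV" "\<And>f. f \<in> B \<Longrightarrow> K f = b f *\<^sub>R f"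
    using spectral_theorem[OF Ks] by blast
  have a: "0 \<le> a e" if "e \<in> A" for e 
    using psd_operator_eigenvalue[OF H A(2) that A(4)[OF that]] .
  have b: "0 \<le> b f" if "f \<in> B" for f 
    using psd_operator_eigenvalue[OF K B(2) that B(4)[OF that]] .
  have unit: "(\<Sum>e\<in>A. (f \<bullet> e)\<^sup>2) = 1" if "f \<in> B" for f
    using orthonormal_inner[OF A(2,1,3), of f f] orthonormal_inner_self[OF B(2) that] 
    by (simp add: power2_eq_square)
  have trH: "optrace (H ^^ Suc M) = (\<Sum>f\<in>B. \<Sum>e\<in>A. (f \<bullet> e)\<^sup>2 * a e ^ Suc M)"
    by (subst optrace_orthonormal[OF linear_funpow[OF lH] B(2,1,3)])
      (simp only: inner_eigenbasis[OF Hs A(2,1,3,4)])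
  have trK: "optrace (K ^^ Suc M) = (\<Sum>f\<in>B. \<Sum>e\<in>A. (f \<bullet> e)\<^sup>2 * b f ^ Suc M)"
    unfolding sum_distrib_right[symmetric]
    by (subst optrace_orthonormal[OF linear_funpow[OF lK] B(2,1,3)], intro sum.cong refl)
      (simp add: unit orthonormal_inner_self[OF B(2)] funpow_eigenvector[OF lK B(4)] del: funpow.simps)
  have trD: "optrace (\<lambda>x. (K ^^ M) (H x - K x)) = (\<Sum>f\<in>B. \<Sum>e\<in>A. (f \<bullet> e)\<^sup>2 * (b f ^ M * (a e - b f)))"
  proof -
    have "linear (\<lambda>x. (K ^^ M) (H x - K x))"
      using linear_compose[OF linear_compose_sub[OF lH lK] linear_funpow[OF lK, of M]] by (simp add: o_def)
    hence "optrace (\<lambda>x. (K ^^ M) (H x - K x)) = (\<Sum>f\<in>B. f \<bullet> (K ^^ M) (H f - K f))"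
      by (rule optrace_orthonormal[OF _ B(2,1,3)])
    also have "\<dots> = (\<Sum>f\<in>B. \<Sum>e\<in>A. (f \<bullet> e)\<^sup>2 * (b f ^ M * (a e - b f)))"
    proof (intro sum.cong refl)
      fix f assume f: "f \<in> B"
      have "f \<bullet> (K ^^ M) (H f - K f) = (K ^^ M) f \<bullet> (H f - K f)"
        by (simp add: selfadjoint_inner[OF selfadjoint_funpow[OF Ks]])
      also have "\<dots> = b f ^ M * (f \<bullet> H f - b f * (f \<bullet> f))"
        by (simp add: funpow_eigenvector[OF lK B(4)[OF f]] B(4)[OF f] inner_diff_right right_diff_distrib)
      also have "f \<bullet> H f = (\<Sum>e\<in>A. (f \<bullet> e)\<^sup>2 * a e)"
        using inner_eigenbasis[OF Hs A(2,1,3,4), of f 1] by simp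
      also have "f \<bullet> f = (\<Sum>e\<in>A. (f \<bullet> e)\<^sup>2)"
        using unit[OF f] orthonormal_inner_self[OF B(2) f] by simp
      finally show "f \<bullet> (K ^^ M) (H f - K f) = (\<Sum>e\<in>A. (f \<bullet> e)\<^sup>2 * (b f ^ M * (a e - b f)))"
        by (simp add: sum_distrib_left sum_subtractf[symmetric] algebra_simps)
    qed
    finally show ?thesis .
  qed
  show ?thesis unfolding trH trK trD sum_distrib_left sum.distrib[symmetric]
  proof (intro sum_mono)
    fix f e assume fe: "f \<in> B" "e \<in> A"
    have "(f \<bullet> e)\<^sup>2 * (b f ^ Suc M + real (Suc M) * b f ^ M * (a e - b f)) \<le> (f \<bullet> e)\<^sup>2 * a e ^ Suc M"
      using power_tangent_le[OF a[OF fe(2)] b[OF fe(1)]] by (intro mult_left_mono) auto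
    thus "(f \<bullet> e)\<^sup>2 * b f ^ Suc M + real (Suc M) * ((f \<bullet> e)\<^sup>2 * (b f ^ M * (a e - b f))) 
       \<le> (f \<bullet> e)\<^sup>2 * a e ^ Suc M"
      by (simp only: distrib_left mult_ac)
  qed
qed

section \<open>Rank-one updates\<close>

definition rank_one :: "'a::euclidean_space \<Rightarrow> 'a \<Rightarrow> 'a" where
  "rank_one u x = (u \<bullet> x) *\<^sub>R u"

lemma selfadjoint_rank_one: "selfadjoint (rank_one u)"
  by (auto simp: selfadjoint_def rank_one_def linear_iff inner_add_right scaleR_add_left inner_commute)

lemma selfadjoint_diff: "selfadjoint f \<Longrightarrow> selfadjoint g \<Longrightarrow> selfadjoint (\<lambda>x. f x - g x)"
  by (auto simp: selfadjoint_def linear_compose_sub inner_diff)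

lemma selfadjoint_scale: "selfadjoint f \<Longrightarrow> selfadjoint (\<lambda>x. s *\<^sub>R f x)"
  by (auto simp: selfadjoint_def linear_compose_scale_right)

lemma selfadjoint_scale_id: "selfadjoint (\<lambda>x. s *\<^sub>R x)"
  by (auto simp: selfadjoint_def linear_scale_self)

lemma selfadjoint_sum: "(\<And>i. i \<in> J \<Longrightarrow> selfadjoint (f i)) \<Longrightarrow> selfadjoint (\<lambda>x. \<Sum>i\<in>J. f i x)"
  by (auto simp: selfadjoint_def linear_compose_sum inner_sum_left inner_sum_right)

lemma optrace_compose_rank_one:
  assumes "selfadjoint f"
  shows "optrace (\<lambda>x. f (s *\<^sub>R rank_one u x)) = s * (u \<bullet> f u)"
proof -
  have lin: "linear f" by (rule selfadjoint_linear[OF assms])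
  have "optrace (\<lambda>x. f (s *\<^sub>R rank_one u x)) = (\<Sum>b\<in>Basis. s * ((u \<bullet> b) * (f u \<bullet> b)))"
    by (simp add: optrace_def rank_one_def linear_scale[OF lin] inner_commute mult_ac)
  also have "\<dots> = s * (u \<bullet> f u)"
    by (simp only: sum_distrib_left[symmetric] euclidean_inner[symmetric])
  finally show ?thesis .
qed

text \<open>
  Telescoping \<open>H\<^sup>M - H'\<^sup>M\<close>, where \<open>H' = H - s u u\<^sup>t\<close>, writes the loss in \<open>u \<bullet> H\<^sup>M u\<close> as \<open>s\<close> times a sum
  of products of one moment of \<open>H'\<close> and one of \<open>H\<close>. All these terms are nonnegative, so first the
  moments of \<open>H'\<close> are at most those of \<open>H\<close>; then \<open>moment_product_le\<close> bounds each product by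
  \<open>(u \<bullet> u) (u \<bullet> H\<^sup>M\<^sup>-\<^sup>1 u)\<close>, and the lower bound \<open>c\<close> on \<open>H\<close> restores the missing power of \<open>H\<close>.
\<close>

lemma moment_rank_one_update_ge:
  assumes H: "psd_operator H" and H': "psd_operator (\<lambda>x. H x - s *\<^sub>R rank_one u x)" 
    and s: "0 \<le> s" and c: "0 < c" "\<And>x. c * (x \<bullet> x) \<le> x \<bullet> H x"
  shows "(1 - s * real M * (u \<bullet> u) / c) * (u \<bullet> (H ^^ M) u) \<le> u \<bullet> ((\<lambda>x. H x - s *\<^sub>R rank_one u x) ^^ M) u"
proof -
  define H' where "H' = (\<lambda>x. H x - s *\<^sub>R rank_one u x)"
  have H'p: "psd_operator H'" using H' by (simp add: H'_def)
  note Hs = psd_operator_selfadjoint[OF H] and H's = psd_operator_selfadjoint[OF H'p]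
  define a where "a = (\<lambda>j. u \<bullet> (H ^^ j) u)"
  define a' where "a' = (\<lambda>j. u \<bullet> (H' ^^ j) u)"
  have a: "0 \<le> a j" and a': "0 \<le> a' j" for j
    unfolding a_def a'_def using psd_operator_nonneg psd_operator_funpow H H'p by blast+
  have tele: "y \<bullet> (H ^^ M) x - y \<bullet> (H' ^^ M) x = 
      (\<Sum>j<M. s * (y \<bullet> (H' ^^ j) u) * (u \<bullet> (H ^^ (M - Suc j)) x))" for x y M
  proof (induction M arbitrary: y)
    case (Suc M)
    have "y \<bullet> (H ^^ Suc M) x - y \<bullet> (H' ^^ Suc M) x
        = y \<bullet> (H ((H ^^ M) x) - H' ((H ^^ M) x)) + (H' y \<bullet> (H ^^ M) x - H' y \<bullet> (H' ^^ M) x)"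
      by (simp add: inner_diff_right selfadjoint_inner[OF H's])
    also have "y \<bullet> (H ((H ^^ M) x) - H' ((H ^^ M) x)) = s * (y \<bullet> u) * (u \<bullet> (H ^^ M) x)"
      by (simp add: H'_def rank_one_def)
    also have "(H' y \<bullet> (H ^^ M) x - H' y \<bullet> (H' ^^ M) x) = 
        (\<Sum>j<M. s * (y \<bullet> (H' ^^ Suc j) u) * (u \<bullet> (H ^^ (M - Suc j)) x))"
      by (subst Suc.IH) (simp add: selfadjoint_inner[OF H's])
    finally show ?case by (simp add: sum.lessThan_Suc_shift del: funpow.simps(2) sum.lessThan_Suc) 
  qed simp
  have le: "a' j \<le> a j" for j
  proof -
    have "a j - a' j = (\<Sum>i<j. s * a' i * a (j - Suc i))"
      unfolding a_def a'_def by (rule tele)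
    also have "\<dots> \<ge> 0" using a a' s by (intro sum_nonneg mult_nonneg_nonneg) auto
    finally show ?thesis by simp
  qed
  show ?thesis
  proof (cases M)
    case (Suc K)
    have ca: "c * a K \<le> a M"
    proof -
      obtain B lam where B: "finite B" "orthonormal B" "span B = UNIV" "\<And>b. b \<in> B \<Longrightarrow> H b = lam b *\<^sub>R b"
        using spectral_theorem[OF Hs] by blast
      have lam: "c \<le> lam b" if "b \<in> B" for b 
        using eigenvalue_ge[OF c(2) B(2) that B(4)[OF that]] .
      have "(u \<bullet> b)\<^sup>2 * (c * lam b ^ K) \<le> (u \<bullet> b)\<^sup>2 * lam b ^ M" if "b \<in> B" for b
        using lam[OF that] c(1) unfolding Suc by (auto intro!: mult_left_mono mult_right_mono)
      hence "c * (\<Sum>b\<in>B. (u \<bullet> b)\<^sup>2 * lam b ^ K) \<le> (\<Sum>b\<in>B. (u \<bullet> b)\<^sup>2 * lam b ^ M)"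
        unfolding sum_distrib_left by (intro sum_mono) (simp add: mult_ac)
      thus ?thesis by (simp add: a_def inner_eigenbasis[OF Hs B(2,1,3,4)])
    qed
    have "a M - a' M = (\<Sum>j<M. s * a' j * a (M - Suc j))"
      unfolding a_def a'_def by (rule tele)
    also have "\<dots> \<le> (\<Sum>j<M. s * ((u \<bullet> u) * a K))"
    proof (intro sum_mono)
      fix j assume "j \<in> {..<M}"
      hence j: "j + (M - Suc j) = K" using Suc by simp
      have "a' j * a (M - Suc j) \<le> a j * a (M - Suc j)" by (intro mult_right_mono le a)
      also have "\<dots> \<le> (u \<bullet> u) * a K"
        using moment_product_le[OF H, of u j "M - Suc j"] j by (simp add: a_def)
      finally show "s * a' j * a (M - Suc j) \<le> s * ((u \<bullet> u) * a K)"
        using s by (simp add: mult.assoc mult_left_mono)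
    qed
    also have "\<dots> = s * real M * (u \<bullet> u) * a K" by simp
    also have "\<dots> \<le> s * real M * (u \<bullet> u) * (a M / c)"
      using ca c(1) s by (intro mult_left_mono) (auto simp: field_simps)
    finally show ?thesis by (simp add: a_def a'_def H'_def algebra_simps)
  qed simp
qed


lemma psd_operator_of_ge:
  assumes "selfadjoint f" "0 \<le> c" "\<And>x. c * (x \<bullet> x) \<le> x \<bullet> f x"
  shows "psd_operator f"
  using assms order_trans[OF mult_nonneg_nonneg[OF assms(2) inner_ge_zero] assms(3)]
  by (simp add: psd_operator_def)

lemma inner_rank_one: "x \<bullet> rank_one u x = (u \<bullet> x)\<^sup>2"
  by (simp add: rank_one_def power2_eq_square inner_commute)

text \<open>
  This is the rank-one Golden--Thompson inequality
  \<open>tr e\<^sup>L\<^sup>-\<^sup>X \<le> tr e\<^sup>L e\<^sup>-\<^sup>X\<close> in a form that needs no matrix exponential: a high power replaces it.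
  Klein's inequality for the full step from \<open>H\<close> to \<open>H - u u\<^sup>t\<close> would give only the factor \<open>1 - y\<close>
  instead of \<open>(1 - exp (-y)) / y\<close>, and the constant of the theorem would be lost. Hence the step is
  cut into \<open>m\<close> equal pieces. In each piece Klein's inequality costs the moment at the new point,
  which by \<open>moment_rank_one_update_ge\<close> shrinks at most by the factor \<open>1 - y/m\<close>; the sum of
  these costs is geometric and converges to the stated factor as \<open>m\<close> grows.
\<close>

lemma optrace_rank_one_update_le:
  fixes H :: "'a::euclidean_space \<Rightarrow> 'a"
  assumes H: "selfadjoint H" and c: "0 < c" "\<And>x. c * (x \<bullet> x) \<le> x \<bullet> H x - (u \<bullet> x)\<^sup>2"
    and B: "u \<bullet> u \<le> B" "0 < B" and M: "0 < M"
  defines "y \<equiv> real M * B / c"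
  shows "optrace ((\<lambda>x. H x - rank_one u x) ^^ Suc M)
     \<le> optrace (H ^^ Suc M) - real (Suc M) * ((1 - exp (-y)) / y) * (u \<bullet> (H ^^ M) u)"
proof -
  have y: "0 < y" using c B M by (simp add: y_def)
  define h where "h = u \<bullet> (H ^^ M) u"
  have step: "optrace ((\<lambda>x. H x - rank_one u x) ^^ Suc M) 
      \<le> optrace (H ^^ Suc M) - real (Suc M) * ((1 - y/m) * (1 - (1 + (-y) / real m) ^ m) / y) * h"
    if m: "0 < m" "y \<le> real m" for m :: nat
  proof -
    \<comment> \<open>The intermediate operators between \<open>H\<close> and \<open>H - u u\<^sup>t\<close>, all bounded below by \<open>c\<close>.\<close>
    define G where "G = (\<lambda>i x. H x - (real i / real m) *\<^sub>R rank_one u x)"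
    define q where "q = 1 - y / real m"
    have q: "0 \<le> q" "q < 1" using m y by (auto simp: q_def field_simps)
    have Gsa: "selfadjoint (G i)" for i unfolding G_def
      by (intro selfadjoint_diff H selfadjoint_scale selfadjoint_rank_one)
    have Gge: "c * (x \<bullet> x) \<le> x \<bullet> G i x" if "i \<le> m" for i x
    proof -
      have "real i / real m * (u \<bullet> x)\<^sup>2 \<le> 1 * (u \<bullet> x)\<^sup>2" using that m 
        by (intro mult_right_mono) auto
      thus ?thesis using c(2)[of x] by (simp add: G_def inner_diff_right inner_rank_one)
    qed
    have Gpos: "psd_operator (G i)" if "i \<le> m" for i
      using psd_operator_of_ge[OF Gsa _ Gge[OF that]] c(1) by simp
    have GSuc: "G (Suc i) = (\<lambda>x. G i x - (1 / real m) *\<^sub>R rank_one u x)" for i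
      by (auto simp: G_def add_divide_distrib algebra_simps)
    have hq: "q ^ i * h \<le> u \<bullet> (G i ^^ M) u" if "i \<le> m" for i using that
    proof (induction i)
      case 0
      show ?case by (simp add: G_def h_def)
    next
      case (Suc i)
      have "1 / real m * real M * (u \<bullet> u) / c \<le> 1 / real m * real M * B / c"
        using B c(1) by (intro divide_right_mono mult_left_mono) auto
      also have "\<dots> = y / real m" by (simp add: y_def)
      finally have "q \<le> 1 - 1 / real m * real M * (u \<bullet> u) / c" by (simp add: q_def)
      moreover have "0 \<le> u \<bullet> (G i ^^ M) u" using Suc.prems
        by (intro psd_operator_nonneg psd_operator_funpow Gpos) simp
      ultimately have "q * (u \<bullet> (G i ^^ M) u) 
          \<le> (1 - 1 / real m * real M * (u \<bullet> u) / c) * (u \<bullet> (G i ^^ M) u)"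
        by (rule mult_right_mono)
      also have "\<dots> \<le> u \<bullet> (G (Suc i) ^^ M) u" unfolding GSuc
        using Suc.prems Gpos[of i] Gpos[of "Suc i"] Gge[of i] c(1)
        by (intro moment_rank_one_update_ge) (auto simp: GSuc)
      finally show ?case using Suc mult_left_mono[OF Suc.IH q(1)] by simp
    qed
    have tr: "optrace (G i ^^ Suc M) \<le> optrace (H ^^ Suc M) - real (Suc M) / real m * (\<Sum>j<i. q ^ Suc j) * h"
      if "i \<le> m" for i using that
    proof (induction i)
      case 0
      show ?case by (simp add: G_def del: funpow.simps)
    next
      case (Suc i)
      have "optrace (G (Suc i) ^^ Suc M) + real (Suc M) * 
              optrace (\<lambda>x. (G (Suc i) ^^ M) (G i x - G (Suc i) x)) \<le> optrace (G i ^^ Suc M)"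
        using Suc.prems by (intro klein_inequality Gpos) auto
      moreover have "optrace (\<lambda>x. (G (Suc i) ^^ M) (G i x - G (Suc i) x)) 
            = 1 / real m * (u \<bullet> (G (Suc i) ^^ M) u)"
        using optrace_compose_rank_one[OF selfadjoint_funpow[OF Gsa[of "Suc i"], of M], of "1 / real m" u]
        by (simp add: GSuc)
      moreover have "real (Suc M) * (1 / real m * (q ^ Suc i * h)) 
          \<le> real (Suc M) * (1 / real m * (u \<bullet> (G (Suc i) ^^ M) u))"
        using hq[OF Suc.prems] m by (intro mult_left_mono) auto
      ultimately have "optrace (G (Suc i) ^^ Suc M) \<le> optrace (G i ^^ Suc M) - real (Suc M) / real m * q ^ Suc i * h"
        by simp
      also have "\<dots> \<le> optrace (H ^^ Suc M) - real (Suc M) / real m * (\<Sum>j<i. q ^ Suc j) * h 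
          - real (Suc M) / real m * q ^ Suc i * h"
        using Suc.IH Suc.prems by (simp del: funpow.simps power_Suc)
      finally show ?case by (simp add: algebra_simps del: funpow.simps power_Suc)
    qed
    have "(\<Sum>j<m. q ^ Suc j) = q * ((1 - q ^ m) / (1 - q))"
      using q by (simp add: sum_distrib_left[symmetric] sum_gp_strict)
    also have "\<dots> / real m = q * (1 - q ^ m) / y" using m y by (simp add: q_def)
    finally have avg: "(\<Sum>j<m. q ^ Suc j) / real m = q * (1 - q ^ m) / y" .
    have "real (Suc M) / real m * (\<Sum>j<m. q ^ Suc j) * h = real (Suc M) * ((\<Sum>j<m. q ^ Suc j) / real m) * h"
      by simp
    also note avg
    finally have "real (Suc M) / real m * (\<Sum>j<m. q ^ Suc j) * h = real (Suc M) * (q * (1 - q ^ m) / y) * h" .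
    moreover have "G m = (\<lambda>x. H x - rank_one u x)" using m by (simp add: G_def)
    ultimately show ?thesis using tr[of m] by (simp add: q_def del: funpow.simps)
  qed
  have lim: "(\<lambda>m. optrace (H ^^ Suc M) - real (Suc M) * ((1 - y/m) * (1 - (1 + (-y) / real m) ^ m) / y) * h)
     \<longlonglongrightarrow> optrace (H ^^ Suc M) - real (Suc M) * ((1 - 0) * (1 - exp (-y)) / y) * h"
    by (intro tendsto_intros tendsto_exp_limit_sequentially lim_const_over_n) (use y in auto)
  have "\<exists>N. \<forall>m\<ge>N. optrace ((\<lambda>x. H x - rank_one u x) ^^ Suc M) \<le> 
      optrace (H ^^ Suc M) - real (Suc M) * ((1 - y/m) * (1 - (1 + (-y) / real m) ^ m) / y) * h"
  proof (intro exI[of _ "nat \<lceil>y\<rceil> + 1"] allI impI)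
    fix m assume "nat \<lceil>y\<rceil> + 1 \<le> m"
    hence "0 < m" "y \<le> real m" by linarith+
    thus "optrace ((\<lambda>x. H x - rank_one u x) ^^ Suc M) \<le> 
      optrace (H ^^ Suc M) - real (Suc M) * ((1 - y/m) * (1 - (1 + (-y) / real m) ^ m) / y) * h"
      by (rule step)
  qed
  from LIMSEQ_le_const[OF lim this] show ?thesis by (simp add: h_def del: funpow.simps)
qed

section \<open>Averaging over a Parseval frame\<close>

text \<open>
  The polarised form of \<open>\<Sum>\<^sub>i u\<^sub>i u\<^sub>i\<^sup>t = I\<close>. The rows of a matrix with orthonormal columns are such a frame.
\<close>

definition parseval_frame :: "('n::finite \<Rightarrow> 'a::euclidean_space) \<Rightarrow> bool" where
  "parseval_frame u \<longleftrightarrow> (\<forall>x y. (\<Sum>i\<in>UNIV. (u i \<bullet> x) * (u i \<bullet> y)) = x \<bullet> y)"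

lemma parseval_frame_optrace:
  fixes u :: "'n::finite \<Rightarrow> 'a::euclidean_space"
  assumes u: "parseval_frame u" and g: "selfadjoint g"
  shows "(\<Sum>i\<in>UNIV. u i \<bullet> g (u i)) = optrace g"
proof -
  have "(\<Sum>i\<in>UNIV. u i \<bullet> g (u i)) = (\<Sum>i\<in>UNIV. \<Sum>b\<in>Basis. (u i \<bullet> b) * (u i \<bullet> g b))"
    by (simp add: euclidean_inner[of "u _" "g (u _)"] selfadjoint_inner[OF g])
  also have "\<dots> = (\<Sum>b\<in>Basis. \<Sum>i\<in>UNIV. (u i \<bullet> b) * (u i \<bullet> g b))" by (rule sum.swap)
  also have "\<dots> = optrace g" using u by (simp add: parseval_frame_def optrace_def)
  finally show ?thesis .
qed

lemma optrace_funpow_eigenbasis: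
  assumes f: "selfadjoint f" and B: "orthonormal B" "finite B" "span B = UNIV"
    and lam: "\<And>b. b \<in> B \<Longrightarrow> f b = lam b *\<^sub>R b"
  shows "optrace (f ^^ n) = (\<Sum>b\<in>B. lam b ^ n)"
  by (subst optrace_orthonormal[OF linear_funpow[OF selfadjoint_linear[OF f]] B], intro sum.cong refl)
    (simp add: orthonormal_inner_self[OF B(1)] funpow_eigenvector[OF selfadjoint_linear[OF f] lam])

lemma optrace_funpow_Suc_le:
  fixes H :: "'a::euclidean_space \<Rightarrow> 'a"
  assumes H: "psd_operator H" and C: "\<And>x. x \<bullet> H x \<le> C * (x \<bullet> x)"
  shows "optrace (H ^^ Suc M) \<le> C * optrace (H ^^ M)"
proof -
  note Hs = psd_operator_selfadjoint[OF H]
  obtain B lam where B: "finite B" "orthonormal B" "span B = UNIV" "\<And>b. b \<in> B \<Longrightarrow> H b = lam b *\<^sub>R b"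
    using spectral_theorem[OF Hs] by blast
  have lam: "0 \<le> lam b" if "b \<in> B" for b using psd_operator_eigenvalue[OF H B(2) that B(4)[OF that]] .
  have lamC: "lam b \<le> C" if "b \<in> B" for b
    using C[of b] B(4)[OF that] orthonormal_inner_self[OF B(2) that] by simp
  have tr: "optrace (H ^^ n) = (\<Sum>b\<in>B. lam b ^ n)" for n
    by (rule optrace_funpow_eigenbasis[OF Hs B(2,1,3,4)])
  show ?thesis unfolding tr sum_distrib_left
    using lam lamC by (intro sum_mono) (auto intro!: mult_right_mono)
qed

text \<open>
  If every eigenvalue were below \<open>d\<close>, then so would be \<open>x \<bullet> H x\<close>, a convex combination of them. This
  is how a small eigenvalue of the sampled frame is detected by a trace.
\<close>

lemma optrace_funpow_ge:
  fixes H :: "'a::euclidean_space \<Rightarrow> 'a"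
  assumes H: "psd_operator H" and x: "x \<bullet> x = 1" "d \<le> x \<bullet> H x" and d: "0 \<le> d"
  shows "d ^ n \<le> optrace (H ^^ n)"
proof -
  note Hs = psd_operator_selfadjoint[OF H]
  obtain B lam where B: "finite B" "orthonormal B" "span B = UNIV" "\<And>b. b \<in> B \<Longrightarrow> H b = lam b *\<^sub>R b"
    using spectral_theorem[OF Hs] by blast
  have lam: "0 \<le> lam b" if "b \<in> B" for b using psd_operator_eigenvalue[OF H B(2) that B(4)[OF that]] .
  have tr: "optrace (H ^^ n) = (\<Sum>b\<in>B. lam b ^ n)"
    by (rule optrace_funpow_eigenbasis[OF Hs B(2,1,3,4)])
  have one: "(\<Sum>b\<in>B. (x \<bullet> b)\<^sup>2) = 1"
    using orthonormal_inner[OF B(2,1,3), of x x] x(1) by (simp add: power2_eq_square)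
  have "\<exists>b\<in>B. d \<le> lam b"
  proof (rule ccontr)
    assume "\<not> (\<exists>b\<in>B. d \<le> lam b)"
    hence lt: "lam b < d" if "b \<in> B" for b using that by force
    obtain b0 where b0: "b0 \<in> B" "(x \<bullet> b0)\<^sup>2 \<noteq> 0" using one by (metis sum.neutral zero_neq_one)
    have "x \<bullet> H x = (\<Sum>b\<in>B. (x \<bullet> b)\<^sup>2 * lam b)" 
      using inner_eigenbasis[OF Hs B(2,1,3,4), of x 1] by simp
    also have "\<dots> < (\<Sum>b\<in>B. (x \<bullet> b)\<^sup>2 * d)"
      using b0 lt B(1) by (intro sum_strict_mono_ex1 ballI mult_left_mono bexI[of _ b0]) (auto simp: less_imp_le)
    also have "\<dots> = d" by (simp add: sum_distrib_right[symmetric] one)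
    finally show False using x(2) by simp
  qed
  then obtain b where b: "b \<in> B" "d \<le> lam b" by blast
  have "d ^ n \<le> lam b ^ n" using b d by (intro power_mono) auto
  also have "\<dots> \<le> optrace (H ^^ n)" unfolding tr using b B(1) lam 
    by (intro member_le_sum) auto
  finally show ?thesis .
qed

lemma optrace_nonneg: "psd_operator f \<Longrightarrow> 0 \<le> optrace f"
  by (auto simp: optrace_def psd_operator_nonneg intro!: sum_nonneg)

text \<open>
  Averaging \<open>optrace_rank_one_update_le\<close> over the frame turns the moments \<open>u\<^sub>i \<bullet> H\<^sup>M u\<^sub>i\<close> into
  \<open>tr H\<^sup>M\<close>, which is at least \<open>tr H\<^sup>M\<^sup>+\<^sup>1 / C\<close>. So one random draw multiplies the expected trace by a
  constant factor below one.
\<close>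

lemma optrace_average_rank_one_update_le:
  fixes u :: "'n::finite \<Rightarrow> 'a::euclidean_space"
  assumes u: "parseval_frame u" and B: "\<And>i. u i \<bullet> u i \<le> B" "0 < B" and M: "0 < M"
    and H: "selfadjoint H" and c: "0 < c" "\<And>i x. c * (x \<bullet> x) \<le> x \<bullet> H x - (u i \<bullet> x)\<^sup>2"
    and C: "0 < C" "\<And>x. x \<bullet> H x \<le> C * (x \<bullet> x)"
  defines "y \<equiv> real M * B / c"
  shows "(\<Sum>i\<in>UNIV. optrace ((\<lambda>x. H x - rank_one (u i) x) ^^ Suc M))
     \<le> (real CARD('n) - real (Suc M) / C * ((1 - exp (-y)) / y)) * optrace (H ^^ Suc M)"
proof -
  have y: "0 < y" using c B M by (simp add: y_def)
  define \<phi> where "\<phi> = (1 - exp (-y)) / y"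
  have \<phi>: "0 \<le> \<phi>" using y by (simp add: \<phi>_def)
  have Hp: "psd_operator H"
  proof (rule psd_operator_of_ge[OF H])
    show "c * (x \<bullet> x) \<le> x \<bullet> H x" for x
      using c(2)[of x undefined] zero_le_power2[of "u undefined \<bullet> x"] by linarith
  qed (use c in simp)
  have "(\<Sum>i\<in>UNIV. optrace ((\<lambda>x. H x - rank_one (u i) x) ^^ Suc M))
    \<le> (\<Sum>i\<in>UNIV. optrace (H ^^ Suc M) - real (Suc M) * \<phi> * (u i \<bullet> (H ^^ M) (u i)))"
    unfolding \<phi>_def y_def by (intro sum_mono optrace_rank_one_update_le H c B M)
  also have "\<dots> = real CARD('n) * optrace (H ^^ Suc M) - real (Suc M) * \<phi> * optrace (H ^^ M)"
    by (simp add: sum_subtractf sum_distrib_left[symmetric] parseval_frame_optrace[OF u selfadjoint_funpow[OF H]] 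
        del: funpow.simps)
  also have "\<dots> \<le> real CARD('n) * optrace (H ^^ Suc M) - real (Suc M) * \<phi> * (optrace (H ^^ Suc M) / C)"
  proof -
    have "optrace (H ^^ Suc M) / C \<le> optrace (H ^^ M)"
      using optrace_funpow_Suc_le[OF Hp C(2), of M] C(1) by (simp add: field_simps del: funpow.simps)
    hence "real (Suc M) * \<phi> * (optrace (H ^^ Suc M) / C) \<le> real (Suc M) * \<phi> * optrace (H ^^ M)"
      using \<phi> by (intro mult_left_mono) auto
    thus ?thesis by linarith
  qed
  also have "\<dots> = (real CARD('n) - real (Suc M) / C * \<phi>) * optrace (H ^^ Suc M)"
    by (simp add: algebra_simps del: funpow.simps)
  finally show ?thesis by (simp add: \<phi>_def)
qed

text \<open>
  The sampled frame operator subtracted from a multiple of the identity: a small eigenvalue of the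
  former is a large eigenvalue of the deficit. The index set \<open>J\<close> grows in the induction over the
  draws.
\<close>

definition deficit :: "('n \<Rightarrow> 'a::euclidean_space) \<Rightarrow> real \<Rightarrow> 'l set \<Rightarrow> ('l \<Rightarrow> 'n) \<Rightarrow> 'a \<Rightarrow> 'a" where
  "deficit u C J s x = C *\<^sub>R x - (\<Sum>j\<in>J. rank_one (u (s j)) x)"

lemma selfadjoint_deficit: "selfadjoint (deficit u C J s)"
proof -
  have "selfadjoint (\<lambda>x. C *\<^sub>R x - (\<Sum>j\<in>J. rank_one (u (s j)) x))"
    by (intro selfadjoint_diff selfadjoint_scale_id selfadjoint_sum selfadjoint_rank_one)
  thus ?thesis by (simp add: deficit_def[abs_def])
qed

lemma inner_deficit: "x \<bullet> deficit u C J s x = C * (x \<bullet> x) - (\<Sum>j\<in>J. (u (s j) \<bullet> x)\<^sup>2)"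
  by (simp add: deficit_def inner_diff_right inner_sum_right inner_rank_one)

lemma deficit_ge:
  assumes B: "\<And>i. u i \<bullet> u i \<le> B"
  shows "(C - real (card J) * B) * (x \<bullet> x) \<le> x \<bullet> deficit u C J s x"
proof -
  have "(u i \<bullet> x)\<^sup>2 \<le> B * (x \<bullet> x)" for i
    using Cauchy_Schwarz_ineq[of "u i" x] mult_right_mono[OF B[of i], of "x \<bullet> x"] by simp
  hence "(\<Sum>j\<in>J. (u (s j) \<bullet> x)\<^sup>2) \<le> (\<Sum>j\<in>J. B * (x \<bullet> x))" by (intro sum_mono)
  thus ?thesis by (simp add: inner_deficit algebra_simps)
qed

lemma deficit_le: "x \<bullet> deficit u C J s x \<le> C * (x \<bullet> x)"
  by (simp add: inner_deficit sum_nonneg)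

lemma psd_operator_deficit:
  assumes "\<And>i. u i \<bullet> u i \<le> B" "real (card J) * B \<le> C"
  shows "psd_operator (deficit u C J s)"
  using assms by (intro psd_operator_of_ge[OF selfadjoint_deficit _ deficit_ge[of u B]]) auto

lemma deficit_insert:
  assumes "finite J" "j \<notin> J"
  shows "deficit u C (insert j J) (s(j := i)) = (\<lambda>x. deficit u C J s x - rank_one (u i) x)"
proof
  fix x
  have "(\<Sum>k\<in>J. rank_one (u ((s(j := i)) k)) x) = (\<Sum>k\<in>J. rank_one (u (s k)) x)"
    using assms by (intro sum.cong) auto
  thus "deficit u C (insert j J) (s(j := i)) x = deficit u C J s x - rank_one (u i) x"
    using assms by (simp add: deficit_def del: fun_upd_apply) simp
qed

lemma optrace_scale_id_funpow:
  "optrace ((\<lambda>x::'a::euclidean_space. C *\<^sub>R x) ^^ n) = real DIM('a) * C ^ n"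
proof -
  have "((\<lambda>x::'a. C *\<^sub>R x) ^^ n) = (\<lambda>x. C ^ n *\<^sub>R x)" by (induction n) auto
  thus ?thesis by (simp add: optrace_def)
qed

text \<open>
  The expected trace for independent uniform draws, up to the normalisation by the number of samples:
  each draw contributes one factor \<open>\<rho>\<close>. The lower bound \<open>C - CARD('l) * B\<close> on the deficit is valid
  at all stages, which makes \<open>\<rho>\<close> the same for all draws.
\<close>

proposition sum_optrace_deficit_le:
  fixes u :: "'n::finite \<Rightarrow> 'a::euclidean_space" and J :: "'l::finite set"
  assumes u: "parseval_frame u" and B: "\<And>i. u i \<bullet> u i \<le> B" "0 < B" and M: "0 < M"
    and C: "real CARD('l) * B < C"
  defines "y \<equiv> real M * B / (C - real CARD('l) * B)"
  defines "\<rho> \<equiv> real CARD('n) - real (Suc M) / C * ((1 - exp (-y)) / y)"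
  shows "(\<Sum>s\<in>PiE J (\<lambda>_. UNIV). optrace (deficit u C J s ^^ Suc M)) \<le> \<rho> ^ card J * (real DIM('a) * C ^ Suc M)"
proof -
  define c where "c = C - real CARD('l) * B"
  have c: "0 < c" using C by (simp add: c_def)
  have "0 \<le> real CARD('l) * B" using B by simp
  hence C0: "0 < C" using C by linarith
  have step: "(\<Sum>i\<in>UNIV. optrace ((\<lambda>x. deficit u C K s x - rank_one (u i) x) ^^ Suc M))
     \<le> \<rho> * optrace (deficit u C K s ^^ Suc M)" if "card K < CARD('l)" for K :: "'l set" and s
    unfolding \<rho>_def y_def c_def[symmetric]
  proof (intro optrace_average_rank_one_update_le[OF u B M selfadjoint_deficit c _ C0 deficit_le])
    fix i x
    have "(u i \<bullet> x)\<^sup>2 \<le> B * (x \<bullet> x)"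
      using Cauchy_Schwarz_ineq[of "u i" x] mult_right_mono[OF B(1)[of i], of "x \<bullet> x"] by simp
    moreover have "(C - real (card K) * B) * (x \<bullet> x) \<le> x \<bullet> deficit u C K s x"
      by (rule deficit_ge[OF B(1)])
    moreover have "c * (x \<bullet> x) \<le> (C - real (card K) * B - B) * (x \<bullet> x)"
    proof (rule mult_right_mono)
      have "(real (card K) + 1) * B \<le> real CARD('l) * B" using that B by (intro mult_right_mono) auto
      thus "c \<le> C - real (card K) * B - B" by (simp add: c_def algebra_simps)
    qed simp
    ultimately show "c * (x \<bullet> x) \<le> x \<bullet> deficit u C K s x - (u i \<bullet> x)\<^sup>2"
      by (simp add: left_diff_distrib)
  qed
  \<comment> \<open>Otherwise the nonnegative trace after the first draw would be bounded by a negative number.\<close>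
  have "0 \<le> \<rho>"
  proof (rule ccontr)
    assume "\<not> 0 \<le> \<rho>"
    have e: "deficit u C ({} :: 'l set) s = (\<lambda>x. C *\<^sub>R x)" for s by (auto simp: deficit_def)
    have pos: "0 < real DIM('a) * C ^ Suc M" using C0 by simp
    have "0 \<le> (\<Sum>i\<in>UNIV. optrace ((\<lambda>x. deficit u C ({} :: 'l set) undefined x - rank_one (u i) x) ^^ Suc M))"
    proof (intro sum_nonneg optrace_nonneg psd_operator_funpow)
      fix i
      have "real (card {undefined :: 'l}) * B \<le> real CARD('l) * B" using B by (intro mult_right_mono) auto
      hence "psd_operator (deficit u C (insert (undefined::'l) {}) (undefined(undefined := i)))"
        using C B(1) by (intro psd_operator_deficit[of u B]) auto
      thus "psd_operator (\<lambda>x. deficit u C ({} :: 'l set) undefined x - rank_one (u i) x)"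
        by (subst (asm) deficit_insert) auto
    qed
    also have "\<dots> \<le> \<rho> * optrace (deficit u C ({} :: 'l set) undefined ^^ Suc M)" by (rule step) simp
    also have "\<dots> = \<rho> * (real DIM('a) * C ^ Suc M)" by (simp only: e optrace_scale_id_funpow)
    also have "\<dots> < 0" using pos \<open>\<not> 0 \<le> \<rho>\<close> by (simp add: mult_neg_pos)
    finally show False by simp
  qed
  have "finite J" by simp
  thus ?thesis
  proof (induction J rule: finite_induct)
    case empty
    have "deficit u C ({} :: 'l set) s = (\<lambda>x. C *\<^sub>R x)" for s by (auto simp: deficit_def)
    thus ?case by (simp add: optrace_scale_id_funpow del: funpow.simps power_Suc)
  next
    case (insert j J)
    have "card (insert j J) \<le> CARD('l)" by (rule card_mono) auto
    hence card: "card J < CARD('l)" using insert by simp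
    have "(\<Sum>s\<in>PiE (insert j J) (\<lambda>_. UNIV). optrace (deficit u C (insert j J) s ^^ Suc M))
       = (\<Sum>(i, s)\<in>UNIV \<times> PiE J (\<lambda>_. UNIV). optrace (deficit u C (insert j J) (s(j := i)) ^^ Suc M))"
      unfolding PiE_insert_eq using insert.hyps
      by (subst sum.reindex[OF inj_combinator]) (auto simp: case_prod_beta o_def simp del: funpow.simps)
    also have "\<dots> = (\<Sum>s\<in>PiE J (\<lambda>_. UNIV). \<Sum>i\<in>UNIV. 
        optrace ((\<lambda>x. deficit u C J s x - rank_one (u i) x) ^^ Suc M))"
      using insert.hyps 
      by (subst sum.swap, subst sum.cartesian_product) (simp add: deficit_insert del: funpow.simps)
    also have "\<dots> \<le> (\<Sum>s\<in>PiE J (\<lambda>_. UNIV). \<rho> * optrace (deficit u C J s ^^ Suc M))"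
      by (intro sum_mono step card)
    also have "\<dots> \<le> \<rho> * (\<rho> ^ card J * (real DIM('a) * C ^ Suc M))"
      unfolding sum_distrib_left[symmetric] using insert.IH \<open>0 \<le> \<rho>\<close> by (rule mult_left_mono)
    finally show ?case using insert.hyps by (simp add: mult_ac del: funpow.simps)
  qed
qed


section \<open>Sampling without replacement\<close>

text \<open>
  Jensen's inequality for \<open>H \<mapsto> tr H\<^sup>M\<^sup>+\<^sup>1\<close>: in the sum of Klein's inequalities at the mean \<open>K\<close> the
  linear terms cancel.
\<close>

lemma optrace_funpow_jensen:
  fixes H :: "'i \<Rightarrow> 'a::euclidean_space \<Rightarrow> 'a"
  assumes H: "\<And>p. p \<in> P \<Longrightarrow> psd_operator (H p)" and K: "psd_operator K"
    and avg: "\<And>x. (\<Sum>p\<in>P. H p x) = real (card P) *\<^sub>R K x"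
  shows "real (card P) * optrace (K ^^ Suc M) \<le> (\<Sum>p\<in>P. optrace (H p ^^ Suc M))"
proof -
  have lin: "linear (K ^^ M)" using K by (simp add: psd_operator_def linear_funpow selfadjoint_linear)
  have "(\<Sum>p\<in>P. optrace (\<lambda>x. (K ^^ M) (H p x - K x))) 
      = (\<Sum>b\<in>Basis. b \<bullet> (K ^^ M) (\<Sum>p\<in>P. H p b - K b))"
    unfolding optrace_def by (subst sum.swap) (simp add: linear_sum[OF lin] inner_sum_right)
  also have "\<dots> = 0" by (simp add: sum_subtractf avg linear_0[OF lin] sum_constant_scaleR)
  finally have zero: "(\<Sum>p\<in>P. optrace (\<lambda>x. (K ^^ M) (H p x - K x))) = 0" .
  have "(\<Sum>p\<in>P. optrace (K ^^ Suc M) + real (Suc M) * optrace (\<lambda>x. (K ^^ M) (H p x - K x))) 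
      \<le> (\<Sum>p\<in>P. optrace (H p ^^ Suc M))"
    by (intro sum_mono klein_inequality H K)
  thus ?thesis unfolding sum.distrib sum_distrib_left[symmetric] zero by (simp del: funpow.simps)
qed

lemma sum_permutations_apply:
  fixes F :: "'l::finite \<Rightarrow> 'a::real_vector"
  shows "(\<Sum>p\<in>{p :: 'l \<Rightarrow> 'l. bij p}. F (p i)) = (real (card {p :: 'l \<Rightarrow> 'l. bij p}) / real CARD('l)) *\<^sub>R (\<Sum>i\<in>UNIV. F i)"
proof -
  let ?P = "{p :: 'l \<Rightarrow> 'l. bij p}"
  have indep: "(\<Sum>p\<in>?P. F (p j)) = (\<Sum>p\<in>?P. F (p i))" for j
  proof (rule sum.reindex_bij_witness[of _ "\<lambda>p. p \<circ> Transposition.transpose i j" "\<lambda>p. p \<circ> Transposition.transpose i j"])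
  qed (auto simp: o_assoc[symmetric] intro: bij_comp)
  have "real CARD('l) *\<^sub>R (\<Sum>p\<in>?P. F (p i)) = (\<Sum>j\<in>(UNIV :: 'l set). \<Sum>p\<in>?P. F (p i))"
    by (simp only: sum_constant_scaleR)
  also have "\<dots> = (\<Sum>j\<in>UNIV. \<Sum>p\<in>?P. F (p j))"
    by (rule sum.cong[OF refl], rule indep[symmetric])
  also have "\<dots> = (\<Sum>p\<in>?P. \<Sum>j\<in>UNIV. F (p j))" by (rule sum.swap)
  also have "\<dots> = (\<Sum>p\<in>?P. \<Sum>j\<in>UNIV. F j)"
    by (intro sum.cong refl sum.reindex_bij_betw) auto
  also have "\<dots> = real (card ?P) *\<^sub>R (\<Sum>j\<in>UNIV. F j)" by (simp add: sum_constant_scaleR)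
  finally have "(1 / real CARD('l)) *\<^sub>R real CARD('l) *\<^sub>R (\<Sum>p\<in>?P. F (p i)) 
      = (1 / real CARD('l)) *\<^sub>R real (card ?P) *\<^sub>R (\<Sum>j\<in>UNIV. F j)" by simp
  thus ?thesis by simp
qed

text \<open>
  Replacing the sample \<open>s\<close> by \<open>s \<circ> p \<circ> \<pi>\<close>, a resampling that may repeat draws, leaves the deficit
  unchanged on average over the permutations \<open>p\<close>, because \<open>p (\<pi> j)\<close> is then uniformly
  distributed for each \<open>j\<close>.
\<close>

lemma deficit_permutation_average:
  fixes u :: "'n \<Rightarrow> 'a::euclidean_space" and \<pi> :: "'l::finite \<Rightarrow> 'l"
  shows "(\<Sum>p\<in>{p :: 'l \<Rightarrow> 'l. bij p}. deficit u C UNIV (s \<circ> p \<circ> \<pi>) x) 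
     = real (card {p :: 'l \<Rightarrow> 'l. bij p}) *\<^sub>R deficit u C UNIV s x"
proof -
  let ?P = "{p :: 'l \<Rightarrow> 'l. bij p}"
  have "(\<Sum>p\<in>?P. \<Sum>j\<in>UNIV. rank_one (u (s (p (\<pi> j)))) x) = (\<Sum>j\<in>UNIV. \<Sum>p\<in>?P. rank_one (u (s (p (\<pi> j)))) x)"
    by (rule sum.swap)
  also have "\<dots> = real (card ?P) *\<^sub>R (\<Sum>j\<in>UNIV. rank_one (u (s j)) x)"
    by (simp add: sum_permutations_apply[of "\<lambda>i. rank_one (u (s i)) x"] sum_constant_scaleR)
  finally show ?thesis
    by (simp add: deficit_def sum_subtractf scaleR_diff_right sum_constant_scaleR)
qed

lemma extend_injection_to_permutation:
  fixes s t :: "'l::finite \<Rightarrow> 'n::finite"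
  assumes "inj s" "inj t"
  obtains h where "bij h" "t = h \<circ> s"
proof -
  have "card (- range s) = card (- range t)"
    by (simp add: Compl_eq_Diff_UNIV card_Diff_subset card_image assms)
  then obtain g where g: "bij_betw g (- range s) (- range t)"
    using finite_same_card_bij[of "- range s" "- range t"] by auto
  define h where "h = (\<lambda>x. if x \<in> range s then t (inv s x) else g x)"
  have "bij_betw (t \<circ> inv s) (range s) (range t)"
  proof (rule bij_betw_trans)
    show "bij_betw (inv s) (range s) UNIV" using assms(1) by (simp add: bij_betw_inv_into inj_imp_bij_betw_inv)
    show "bij_betw t UNIV (range t)" using assms(2) by (simp add: bij_betw_def)
  qed
  hence "bij_betw h (range s) (range t)"
    by (rule bij_betw_cong[THEN iffD1, rotated]) (simp add: h_def)
  moreover have "bij_betw h (- range s) (- range t)"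
    using g by (rule bij_betw_cong[THEN iffD1, rotated]) (simp add: h_def)
  ultimately have "bij_betw h (range s \<union> - range s) (range t \<union> - range t)"
    by (rule bij_betw_combine) auto
  hence "bij h" by simp
  moreover have "t = h \<circ> s" using assms(1) by (auto simp: h_def)
  ultimately show thesis using that by blast
qed

lemma factor_through_injection:
  fixes s :: "'l::finite \<Rightarrow> 'n::finite"
  assumes "CARD('l) \<le> CARD('n)"
  obtains \<sigma> :: "'l \<Rightarrow> 'n" and \<pi> :: "'l \<Rightarrow> 'l" where "inj \<sigma>" "s = \<sigma> \<circ> \<pi>"
proof -
  have "card (range s) \<le> CARD('l)" by (rule card_image_le) simp
  then obtain R where R: "range s \<subseteq> R" "card R = CARD('l)"
    using exists_subset_between[of "range s" "CARD('l)" "UNIV :: 'n set"] assms by auto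
  obtain \<sigma> where \<sigma>: "bij_betw \<sigma> (UNIV :: 'l set) R"
    using finite_same_card_bij[of "UNIV :: 'l set" R] R by auto
  have "s = \<sigma> \<circ> (inv \<sigma> \<circ> s)"
    using \<sigma> R(1) by (auto simp: fun_eq_iff bij_betw_def f_inv_into_f subset_iff)
  moreover have "inj \<sigma>" using \<sigma> by (simp add: bij_betw_def)
  ultimately show thesis using that by blast
qed

text \<open>
  A uniformly random permutation composed with any fixed injection is a uniformly random injection:
  the left-hand sum is the same for every injection, and summing it over all of them counts each
  one once per permutation.
\<close>

lemma sum_permutations_of_injection:
  fixes \<sigma> :: "'l::finite \<Rightarrow> 'n::finite" and F :: "('l \<Rightarrow> 'n) \<Rightarrow> real"
  assumes "inj \<sigma>"
  shows "real (card {s :: 'l \<Rightarrow> 'n. inj s}) * (\<Sum>g\<in>{g. bij g}. F (g \<circ> \<sigma>)) 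
      = real (card {g :: 'n \<Rightarrow> 'n. bij g}) * (\<Sum>s\<in>{s. inj s}. F s)"
proof -
  let ?Q = "{g :: 'n \<Rightarrow> 'n. bij g}" and ?I = "{s :: 'l \<Rightarrow> 'n. inj s}"
  have indep: "(\<Sum>g\<in>?Q. F (g \<circ> s)) = (\<Sum>g\<in>?Q. F (g \<circ> \<sigma>))" if s: "inj s" for s
  proof -
    obtain h where h: "bij h" "s = h \<circ> \<sigma>" 
      using extend_injection_to_permutation[OF assms s] by blast
    show ?thesis
    proof (rule sum.reindex_bij_witness[of _ "\<lambda>g. g \<circ> inv h" "\<lambda>g. g \<circ> h"])
      fix g :: "'n \<Rightarrow> 'n" assume "g \<in> ?Q"
      thus "g \<circ> h \<in> ?Q" "g \<circ> inv h \<in> ?Q" using h(1) by (auto intro: bij_comp bij_imp_bij_inv)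
      show "g \<circ> h \<circ> inv h = g" "g \<circ> inv h \<circ> h = g"
        using h(1) by (auto simp: fun_eq_iff bij_is_inj bij_is_surj surj_f_inv_f)
      show "F (g \<circ> h \<circ> \<sigma>) = F (g \<circ> s)" by (simp add: h(2) o_assoc)
    qed
  qed
  have "real (card ?I) * (\<Sum>g\<in>?Q. F (g \<circ> \<sigma>)) = (\<Sum>s\<in>?I. \<Sum>g\<in>?Q. F (g \<circ> \<sigma>))"
    by simp
  also have "\<dots> = (\<Sum>s\<in>?I. \<Sum>g\<in>?Q. F (g \<circ> s))"
    by (rule sum.cong[OF refl], rule indep[symmetric]) simp
  also have "\<dots> = (\<Sum>g\<in>?Q. \<Sum>s\<in>?I. F (g \<circ> s))" by (rule sum.swap)
  also have "\<dots> = (\<Sum>g\<in>?Q. \<Sum>s\<in>?I. F s)"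
  proof (rule sum.cong[OF refl])
    fix g :: "'n \<Rightarrow> 'n" assume "g \<in> ?Q"
    thus "(\<Sum>s\<in>?I. F (g \<circ> s)) = (\<Sum>s\<in>?I. F s)"
      by (intro sum.reindex_bij_witness[of _ "\<lambda>s. inv g \<circ> s" "\<lambda>s. g \<circ> s"])
        (auto simp: o_assoc bij_is_inj bij_is_surj surj_iff[THEN iffD1] bij_imp_bij_inv intro!: inj_compose)
  qed
  finally show ?thesis by simp
qed

text \<open>
  Hoeffding's comparison: the mean of a convex statistic \<open>G\<close> over samples without replacement is
  at most its mean over samples with replacement. Convexity enters as the inequality
  \<open>jensen\<close>: resampling through any \<open>\<pi>\<close>, averaged over permutations, does not decrease \<open>G\<close>.
  Every sample \<open>s\<close> factors as \<open>\<sigma> \<circ> \<pi>\<close> with \<open>\<sigma>\<close> injective and \<open>\<pi>\<close> recording the repetitions;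
  relabelling the columns makes \<open>\<sigma>\<close> a uniform injection (\<open>orbit\<close>), and for fixed
  \<open>\<pi>\<close> repetitions only increase the mean (\<open>merge\<close>).
\<close>

theorem hoeffding_without_replacement:
  fixes G :: "('l::finite \<Rightarrow> 'n::finite) \<Rightarrow> real"
  assumes card: "CARD('l) \<le> CARD('n)"
    and jensen: "\<And>s (\<pi> :: 'l \<Rightarrow> 'l). real (card {p :: 'l \<Rightarrow> 'l. bij p}) * G s \<le> (\<Sum>p\<in>{p. bij p}. G (s \<circ> p \<circ> \<pi>))"
  shows "real CARD('n) ^ CARD('l) * (\<Sum>s\<in>{s. inj s}. G s) \<le> real (card {s :: 'l \<Rightarrow> 'n. inj s}) * (\<Sum>s\<in>UNIV. G s)"
proof -
  let ?P = "{p :: 'l \<Rightarrow> 'l. bij p}" and ?Q = "{g :: 'n \<Rightarrow> 'n. bij g}" and ?I = "{s :: 'l \<Rightarrow> 'n. inj s}"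
  have P0: "0 < real (card ?P)" and Q0: "0 < real (card ?Q)"
    using bij_id by (auto simp: card_gt_0_iff intro!: exI[of _ id])
  have merge: "(\<Sum>s\<in>?I. G s) \<le> (\<Sum>s\<in>?I. G (s \<circ> \<pi>))" for \<pi> :: "'l \<Rightarrow> 'l"
  proof -
    have "real (card ?P) * (\<Sum>s\<in>?I. G s) \<le> (\<Sum>s\<in>?I. \<Sum>p\<in>?P. G (s \<circ> p \<circ> \<pi>))"
      unfolding sum_distrib_left by (intro sum_mono jensen)
    also have "\<dots> = (\<Sum>p\<in>?P. \<Sum>s\<in>?I. G (s \<circ> p \<circ> \<pi>))" by (rule sum.swap)
    also have "\<dots> = (\<Sum>p\<in>?P. \<Sum>s\<in>?I. G (s \<circ> \<pi>))"
    proof (rule sum.cong[OF refl])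
      fix p :: "'l \<Rightarrow> 'l" assume "p \<in> ?P"
      thus "(\<Sum>s\<in>?I. G (s \<circ> p \<circ> \<pi>)) = (\<Sum>s\<in>?I. G (s \<circ> \<pi>))"
        by (intro sum.reindex_bij_witness[of _ "\<lambda>s. s \<circ> inv p" "\<lambda>s. s \<circ> p"])
          (auto simp: o_assoc[symmetric] bij_is_inj bij_is_surj surj_iff[THEN iffD1] bij_imp_bij_inv intro!: inj_compose)
    qed
    finally show ?thesis using P0 by simp
  qed
  have orbit: "real (card ?Q) * (\<Sum>s\<in>?I. G s) \<le> real (card ?I) * (\<Sum>g\<in>?Q. G (g \<circ> s))" for s
  proof -
    obtain \<sigma> :: "'l \<Rightarrow> 'n" and \<pi> :: "'l \<Rightarrow> 'l" where s: "inj \<sigma>" "s = \<sigma> \<circ> \<pi>" by (rule factor_through_injection[OF card, of s])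
    have "real (card ?Q) * (\<Sum>s\<in>?I. G s) \<le> real (card ?Q) * (\<Sum>s\<in>?I. G (s \<circ> \<pi>))"
      by (intro mult_left_mono merge) simp
    also have "\<dots> = real (card ?I) * (\<Sum>g\<in>?Q. G (g \<circ> s))"
      using sum_permutations_of_injection[OF s(1), of "\<lambda>t. G (t \<circ> \<pi>)"] by (simp add: s(2) o_assoc)
    finally show ?thesis .
  qed
  have "real (card ?Q) * (real CARD('n) ^ CARD('l) * (\<Sum>s\<in>?I. G s)) 
      = (\<Sum>s\<in>(UNIV :: ('l \<Rightarrow> 'n) set). real (card ?Q) * (\<Sum>s\<in>?I. G s))"
    by (simp add: card_fun)
  also have "\<dots> \<le> (\<Sum>s\<in>UNIV. real (card ?I) * (\<Sum>g\<in>?Q. G (g \<circ> s)))"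
    by (intro sum_mono orbit)
  also have "\<dots> = real (card ?I) * (\<Sum>g\<in>?Q. \<Sum>s\<in>UNIV. G (g \<circ> s))"
    by (subst sum.swap) (simp add: sum_distrib_left)
  also have "(\<Sum>g\<in>?Q. \<Sum>s\<in>UNIV. G (g \<circ> s)) = (\<Sum>g\<in>?Q. \<Sum>s\<in>UNIV. G s)"
  proof (rule sum.cong[OF refl])
    fix g :: "'n \<Rightarrow> 'n" assume "g \<in> ?Q"
    thus "(\<Sum>s\<in>UNIV. G (g \<circ> s)) = (\<Sum>s\<in>UNIV. G s)"
      by (intro sum.reindex_bij_witness[of _ "\<lambda>s. inv g \<circ> s" "\<lambda>s. g \<circ> s"])
        (auto simp: o_assoc bij_is_inj bij_is_surj surj_iff[THEN iffD1])
  qed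
  finally have "real (card ?Q) * (real CARD('n) ^ CARD('l) * (\<Sum>s\<in>?I. G s)) 
      \<le> real (card ?Q) * (real (card ?I) * (\<Sum>s\<in>UNIV. G s))" by (simp add: mult_ac)
  thus ?thesis using Q0 by simp
qed

section \<open>The matrix Chernoff bound\<close>

text \<open>
  The Laplace transform method with \<open>(C I - Y)\<^sup>M\<^sup>+\<^sup>1\<close> in place of \<open>exp (- \<theta> Y)\<close>, where
  \<open>C = (M + 1) / \<theta>\<close>: Markov's inequality for the trace of this power, Hoeffding's comparison, and the
  bound on the expected trace for independent draws. Letting \<open>M\<close> grow gives the exponential form.
\<close>

theorem matrix_chernoff_rank_one_without_replacement:
  fixes u :: "'n::finite \<Rightarrow> 'a::euclidean_space"
  assumes card: "CARD('l::finite) \<le> CARD('n)"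
    and u: "parseval_frame u" and B: "\<And>i. u i \<bullet> u i \<le> B" "0 < B" and \<theta>: "0 < \<theta>"
  shows "real (card {s :: 'l \<Rightarrow> 'n. inj s \<and> (\<exists>x. x \<bullet> x = 1 \<and> (\<Sum>j\<in>UNIV. (u (s j) \<bullet> x)\<^sup>2) < t)})
      \<le> real (card {s :: 'l \<Rightarrow> 'n. inj s}) * (real DIM('a) * exp (\<theta> * t)
           * (1 - (1 - exp (- (\<theta> * B))) / (real CARD('n) * B)) ^ CARD('l))"
proof -
  let ?I = "{s :: 'l \<Rightarrow> 'n. inj s}"
  define n l where "n = real CARD('n)" and "l = CARD('l)"
  have n0: "0 < n" by (simp add: n_def)
  define bad where "bad = {s :: 'l \<Rightarrow> 'n. inj s \<and> (\<exists>x. x \<bullet> x = 1 \<and> (\<Sum>j\<in>UNIV. (u (s j) \<bullet> x)\<^sup>2) < t)}"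
  define y where "y = (\<lambda>M::nat. real M * B / (real (Suc M) / \<theta> - real l * B))"
  define r where "r = (\<lambda>M. 1 - \<theta> * ((1 - exp (- y M)) / y M) / n)"
  have main: "real (card bad) * (1 - \<theta> * t / real (Suc M)) ^ Suc M \<le> real (card ?I) * (r M ^ l * real DIM('a))"
    if M: "0 < M" and M1: "real l * B * \<theta> < real (Suc M)" and M2: "t * \<theta> \<le> real (Suc M)" for M
  proof -
    define C where "C = real (Suc M) / \<theta>"
    have C: "real l * B < C" "t \<le> C" "0 < C" using M1 M2 \<theta> by (simp_all add: C_def pos_less_divide_eq pos_le_divide_eq)
    define G where "G = (\<lambda>s :: 'l \<Rightarrow> 'n. optrace (deficit u C UNIV s ^^ Suc M))"
    have pos: "psd_operator (deficit u C UNIV s)" for s :: "'l \<Rightarrow> 'n"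
      using C(1) B(1) by (intro psd_operator_deficit[of u B]) (auto simp: l_def)
    have G0: "0 \<le> G s" for s unfolding G_def by (intro optrace_nonneg psd_operator_funpow pos)
    have Gbad: "(C - t) ^ Suc M \<le> G s" if "s \<in> bad" for s
    proof -
      obtain x where x: "x \<bullet> x = 1" "(\<Sum>j\<in>UNIV. (u (s j) \<bullet> x)\<^sup>2) < t"
        using \<open>s \<in> bad\<close> by (auto simp: bad_def)
      show ?thesis unfolding G_def
        by (rule optrace_funpow_ge[OF pos x(1)]) (use x C in \<open>auto simp: inner_deficit\<close>)
    qed
    have "n ^ l * (real (card bad) * (C - t) ^ Suc M) = n ^ l * (\<Sum>s\<in>bad. (C - t) ^ Suc M)" by simp
    also have "\<dots> \<le> n ^ l * (\<Sum>s\<in>bad. G s)"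
      using n0 by (intro mult_left_mono sum_mono Gbad) auto
    also have "\<dots> \<le> n ^ l * (\<Sum>s\<in>?I. G s)"
      using n0 G0 by (intro mult_left_mono sum_mono2) (auto simp: bad_def)
    also have "\<dots> \<le> real (card ?I) * (\<Sum>s\<in>UNIV. G s)"
      unfolding n_def l_def
    proof (rule hoeffding_without_replacement[OF card])
      show "real (card {p :: 'l \<Rightarrow> 'l. bij p}) * G s \<le> (\<Sum>p\<in>{p. bij p}. G (s \<circ> p \<circ> \<pi>))" 
        for s and \<pi> :: "'l \<Rightarrow> 'l"
        unfolding G_def by (intro optrace_funpow_jensen pos deficit_permutation_average)
    qed
    also have "(\<Sum>s\<in>UNIV. G s) \<le> (n - real (Suc M) / C * ((1 - exp (- y M)) / y M)) ^ l * (real DIM('a) * C ^ Suc M)"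
      using sum_optrace_deficit_le[OF u B M C(1)[unfolded l_def], of "UNIV :: 'l set"]
      by (simp add: G_def n_def l_def y_def C_def PiE_UNIV_domain del: funpow.simps power_Suc)
    also have "(n - real (Suc M) / C * ((1 - exp (- y M)) / y M)) = n * r M"
    proof -
      have "real (Suc M) / C = \<theta>" using \<theta> by (simp add: C_def)
      moreover have "n * (1 - a / n) = n - a" for a using n0 by (simp add: right_diff_distrib)
      ultimately show ?thesis unfolding r_def by (simp only:)
    qed
    finally have "n ^ l * (real (card bad) * (C - t) ^ Suc M) 
       \<le> real (card ?I) * ((n * r M) ^ l * (real DIM('a) * C ^ Suc M))"
      by (simp add: mult_left_mono del: power_Suc)
    moreover have Ct: "C - t = C * (1 - \<theta> * t / real (Suc M))"
    proof -
      have "\<theta> * t / real (Suc M) = t / C" by (simp add: C_def)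
      thus ?thesis using C(3) by (simp only: right_diff_distrib) simp
    qed
    ultimately have "n ^ l * (real (card bad) * (C * (1 - \<theta> * t / real (Suc M))) ^ Suc M) 
       \<le> real (card ?I) * ((n * r M) ^ l * (real DIM('a) * C ^ Suc M))" 
      by (simp only:)
    hence "(n ^ l * C ^ Suc M) * (real (card bad) * (1 - \<theta> * t / real (Suc M)) ^ Suc M)
       \<le> (n ^ l * C ^ Suc M) * (real (card ?I) * (r M ^ l * real DIM('a)))"
      by (simp only: power_mult_distrib mult_ac)
    thus ?thesis using n0 C(3) by (subst (asm) mult_le_cancel_left_pos) auto
  qed
  have ylim: "y \<longlonglongrightarrow> \<theta> * B"
  proof -
    have "(\<lambda>M. B / ((1 + 1 / real M) / \<theta> - (real l * B) / real M)) \<longlonglongrightarrow> B / ((1 + 0) / \<theta> - 0)"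
      by (intro tendsto_intros lim_const_over_n) (use \<theta> in auto)
    moreover have "\<forall>\<^sub>F M in sequentially. B / ((1 + 1 / real M) / \<theta> - (real l * B) / real M) = y M"
      using eventually_gt_at_top[of "0::nat"]
    proof eventually_elim
      case (elim M)
      have "(1 + 1 / real M) / \<theta> - (real l * B) / real M = (real (Suc M) / \<theta> - real l * B) / real M"
        using elim \<theta> by (simp add: field_simps)
      thus ?case by (simp add: y_def)
    qed
    ultimately have "y \<longlonglongrightarrow> B / ((1 + 0) / \<theta> - 0)" by (rule Lim_transform_eventually)
    thus ?thesis by (simp add: mult.commute)
  qed
  have rlim: "r \<longlonglongrightarrow> 1 - \<theta> * ((1 - exp (- (\<theta> * B))) / (\<theta> * B)) / n"
    unfolding r_def by (intro tendsto_intros ylim) (use \<theta> B n0 in auto)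
  have "(\<lambda>M. (1 + (- (\<theta> * t)) / real (Suc M)) ^ Suc M) \<longlonglongrightarrow> exp (- (\<theta> * t))"
    by (rule filterlim_compose[OF tendsto_exp_limit_sequentially filterlim_Suc])
  hence "(\<lambda>M. real (card bad) * (1 + (- (\<theta> * t)) / real (Suc M)) ^ Suc M) \<longlonglongrightarrow> real (card bad) * exp (- (\<theta> * t))"
    by (intro tendsto_intros)
  moreover have "(\<lambda>M. real (card ?I) * (r M ^ l * real DIM('a))) 
      \<longlonglongrightarrow> real (card ?I) * ((1 - \<theta> * ((1 - exp (- (\<theta> * B))) / (\<theta> * B)) / n) ^ l * real DIM('a))"
    by (intro tendsto_intros rlim)
  moreover have "\<exists>N. \<forall>M\<ge>N. real (card bad) * (1 + (- (\<theta> * t)) / real (Suc M)) ^ Suc M 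
      \<le> real (card ?I) * (r M ^ l * real DIM('a))"
  proof (intro exI[of _ "nat \<lceil>real l * B * \<theta>\<rceil> + nat \<lceil>t * \<theta>\<rceil> + 1"] allI impI)
    fix M assume "nat \<lceil>real l * B * \<theta>\<rceil> + nat \<lceil>t * \<theta>\<rceil> + 1 \<le> M"
    hence "0 < M" "real l * B * \<theta> < real (Suc M)" "t * \<theta> \<le> real (Suc M)" by linarith+
    from main[OF this] show "real (card bad) * (1 + (- (\<theta> * t)) / real (Suc M)) ^ Suc M 
      \<le> real (card ?I) * (r M ^ l * real DIM('a))" by simp
  qed
  ultimately have "real (card bad) * exp (- (\<theta> * t)) 
      \<le> real (card ?I) * ((1 - \<theta> * ((1 - exp (- (\<theta> * B))) / (\<theta> * B)) / n) ^ l * real DIM('a))"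
    by (rule LIMSEQ_le)
  also have "\<theta> * ((1 - exp (- (\<theta> * B))) / (\<theta> * B)) / n = (1 - exp (- (\<theta> * B))) / (n * B)"
    using \<theta> by simp
  finally have "real (card bad) * exp (- (\<theta> * t)) * exp (\<theta> * t)
      \<le> real (card ?I) * ((1 - (1 - exp (- (\<theta> * B))) / (n * B)) ^ l * real DIM('a)) * exp (\<theta> * t)"
    by (rule mult_right_mono) simp
  moreover have "exp (- (\<theta> * t)) * exp (\<theta> * t) = 1" by (simp add: exp_minus)
  ultimately have "real (card bad) 
      \<le> real (card ?I) * ((1 - (1 - exp (- (\<theta> * B))) / (n * B)) ^ l * real DIM('a)) * exp (\<theta> * t)"
    by (simp only: mult.assoc mult_1_right)
  thus ?thesis by (simp add: bad_def n_def l_def mult_ac)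
qed


section \<open>Eigenvalues as roots of the characteristic polynomial\<close>

lemma matrix_inner_transpose:
  fixes A :: "real^'n^'m"
  shows "x \<bullet> (A *v y) = (transpose A *v x) \<bullet> y"
  by (simp add: transpose_matrix_vector dot_lmul_matrix)

text \<open>
  Products with a transposed matrix stay in the form that \<open>matrix_inner_transpose\<close> produces.
\<close>

declare transpose_matrix_vector [simp del]

lemma selfadjoint_matrix_iff:
  fixes A :: "real^'n^'n"
  shows "selfadjoint ((*v) A) \<longleftrightarrow> transpose A = A"
proof
  assume "selfadjoint ((*v) A)"
  hence "(transpose A *v x) \<bullet> y = (A *v x) \<bullet> y" for x y
    by (simp add: matrix_inner_transpose[symmetric] selfadjoint_inner)
  hence "transpose A *v x = A *v x" for x using vector_eq_rdot by blast
  thus "transpose A = A" by (simp add: matrix_eq)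
next
  assume "transpose A = A"
  thus "selfadjoint ((*v) A)"
    by (simp add: selfadjoint_def matrix_inner_transpose)
qed

lemma psd_operator_matrix_iff: "psd_operator ((*v) A) \<longleftrightarrow> psd_matrix A"
  by (simp add: psd_operator_def psd_matrix_def selfadjoint_matrix_iff)

lemma poly_det:
  fixes M :: "real poly^'n^'n"
  shows "poly (det M) x = det (\<chi> i j. poly (M $ i $ j) x)"
  by (simp add: det_def poly_sum poly_prod)

text \<open>
  Conjugation by the orthogonal matrix of the eigenbasis diagonalises \<open>x I - A\<close>. Determinants are
  compared at every real \<open>x\<close> rather than over the polynomial ring, so that only real matrices
  have to be multiplied.
\<close>

lemma proots_charpoly_eigenbasis:
  fixes A :: "real^'n^'n"
  assumes B: "orthonormal B" "finite B" "span B = UNIV" 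
    and lam: "\<And>b. b \<in> B \<Longrightarrow> A *v b = lam b *\<^sub>R b"
  shows "proots (charpoly A) = image_mset lam (mset_set B)"
proof -
  have "0 \<notin> B" using B(1) by (auto simp: orthonormal_def)
  hence ind: "independent B" using B(1) by (intro pairwise_orthogonal_independent) (auto simp: orthonormal_def)
  hence "card B = CARD('n)" using basis_card_eq_dim[of B UNIV] B(3) by simp
  then obtain f where f: "bij_betw f (UNIV :: 'n set) B"
    using finite_same_card_bij[of "UNIV :: 'n set" B] B(2) by auto
  hence fB: "f i \<in> B" for i by (auto simp: bij_betw_def)
  define P :: "real^'n^'n" where "P = (\<chi> i j. f j $ i)"
  have "transpose P ** P = mat 1"
  proof -
    have "f i \<bullet> f j = (if i = j then 1 else 0)" for i j
    proof (cases "i = j")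
      case False
      hence "f i \<noteq> f j" using f by (auto simp: bij_betw_def inj_on_def)
      thus ?thesis using B(1) fB False by (auto simp: orthonormal_def pairwise_def orthogonal_def)
    qed (simp add: orthonormal_inner_self[OF B(1) fB])
    thus ?thesis
      by (simp add: vec_eq_iff matrix_matrix_mult_def transpose_def P_def mat_def inner_vec_def)
  qed
  hence "det (transpose P ** P) = 1" by simp
  hence detP: "det P \<noteq> 0" by (auto simp: det_mul)
  have eval: "poly (charpoly A) x = (\<Prod>b\<in>B. x - lam b)" for x
  proof -
    define D :: "real^'n^'n" where "D = (\<chi> i j. if i = j then x - lam (f j) else 0)"
    have "poly (charpoly A) x = det (\<chi> i j. (if i = j then x else 0) - A $ i $ j)"
      unfolding charpoly_def poly_det by (rule arg_cong[where f=det]) (simp add: vec_eq_iff)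
    also have "(\<chi> i j. (if i = j then x else 0) - A $ i $ j) = mat x - A"
      by (simp add: vec_eq_iff mat_def)
    finally have p: "poly (charpoly A) x = det (mat x - A)" .
    have "(mat x - A) ** P = P ** D"
    proof (simp add: vec_eq_iff, intro allI)
      fix i j
      have "((mat x - A) ** P) $ i $ j = ((mat x - A) *v f j) $ i"
        by (simp add: matrix_matrix_mult_def matrix_vector_mult_def P_def)
      also have "(mat x - A) *v f j = (x - lam (f j)) *\<^sub>R f j"
      proof -
        have "mat x *v f j = x *\<^sub>R f j"
          by (simp add: vec_eq_iff matrix_vector_mult_def mat_def if_distrib[of "\<lambda>c. c * _"] cong: if_cong)
        thus ?thesis by (simp add: matrix_vector_mult_diff_rdistrib lam[OF fB] scaleR_diff_left)
      qed
      also have "((x - lam (f j)) *\<^sub>R f j) $ i = (P ** D) $ i $ j"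
        by (simp add: matrix_matrix_mult_def P_def D_def if_distrib[of "\<lambda>c. _ * c"] mult.commute cong: if_cong)
      finally show "((mat x - A) ** P) $ i $ j = (P ** D) $ i $ j" .
    qed
    hence "det (mat x - A) * det P = det P * det D" by (metis det_mul)
    hence "det (mat x - A) = det D" using detP by simp
    also have "\<dots> = (\<Prod>i\<in>UNIV. x - lam (f i))"
      by (subst det_diagonal) (auto simp: D_def)
    also have "\<dots> = (\<Prod>b\<in>B. x - lam b)" by (rule prod.reindex_bij_betw[OF f])
    finally show ?thesis using p by simp
  qed
  have "charpoly A = (\<Prod>b\<in>B. [:- lam b, 1:])"
    by (subst poly_eq_poly_eq_iff[symmetric]) (simp add: fun_eq_iff eval poly_prod)
  also have "proots \<dots> = (\<Sum>b\<in>B. {#lam b#})"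
    by (subst proots_prod) auto
  also have "\<dots> = image_mset lam (mset_set B)"
    using B(2) by (induction B rule: finite_induct) auto
  finally show ?thesis .
qed

text \<open>
  The given dominant eigenvectors are completed to an eigenbasis by one of their orthogonal
  complement. Its eigenvalues together with the first \<open>k\<close> entries of the decreasing list are all the
  roots of the characteristic polynomial, so those of the complement are the remaining entries of
  the list, and the largest of these is \<open>eigenval A (k + 1)\<close>.
\<close>

lemma dominant_complement_form_le:
  fixes A :: "real^'n^'n"
  assumes A: "psd_matrix A" and dom: "dominant_invariant_subspace A k S"
  shows "0 \<le> eigenval A (k + 1)" 
    and "(\<And>w. w \<in> S \<Longrightarrow> w \<bullet> z = 0) \<Longrightarrow> z \<bullet> (A *v z) \<le> eigenval A (k + 1) * (z \<bullet> z)"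
proof -
  have pos: "psd_operator ((*v) A)" using A by (simp add: psd_operator_matrix_iff)
  note sa = psd_operator_selfadjoint[OF pos]
  from dom obtain v :: "nat \<Rightarrow> real^'n" where
    v: "\<And>i j. i \<in> {1..k} \<Longrightarrow> j \<in> {1..k} \<Longrightarrow> v i \<bullet> v j = (if i = j then 1 else 0)"
    and Av: "\<And>i. i \<in> {1..k} \<Longrightarrow> A *v v i = eigenval A i *\<^sub>R v i"
    and S: "S = span (v ` {1..k})"
    unfolding dominant_invariant_subspace_def by blast
  define V where "V = v ` {1..k}"
  have inj: "inj_on v {1..k}"
  proof (rule inj_onI)
    fix i j assume ij: "i \<in> {1..k}" "j \<in> {1..k}" "v i = v j"
    have "v i \<bullet> v j = 1" using v[of i i] ij by simp
    thus "i = j" using v[OF ij(1,2)] by (simp split: if_splits)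
  qed
  define W where "W = {z. \<forall>i\<in>{1..k}. v i \<bullet> z = 0}"
  have W: "subspace W" by (auto simp: W_def subspace_def inner_add_right)
  have "v i \<bullet> (A *v z) = 0" if "i \<in> {1..k}" "z \<in> W" for i z
    using that selfadjoint_inner[OF sa, of "v i" z] Av by (auto simp: W_def)
  hence "(*v) A ` W \<subseteq> W" by (auto simp: W_def)
  from spectral_theorem_invariant_subspace[OF sa W this] obtain B lam where
    B: "B \<subseteq> W" "finite B" "orthonormal B" "span B = W" "\<And>b. b \<in> B \<Longrightarrow> A *v b = lam b *\<^sub>R b" 
    by blast
  have disj: "V \<inter> B = {}"
  proof -
    have "v i \<notin> W" if "i \<in> {1..k}" for i using v[OF that that] that by (force simp: W_def)
    thus ?thesis using B(1) by (auto simp: V_def)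
  qed
  define F where "F = V \<union> B"
  have F: "finite F" using B(2) by (simp add: F_def V_def)
  have Fo: "orthonormal F"
  proof -
    have "pairwise orthogonal F"
      unfolding pairwise_def orthogonal_def F_def
    proof (intro ballI impI)
      fix x y assume xy: "x \<in> V \<union> B" "y \<in> V \<union> B" "x \<noteq> y"
      have VB: "a \<bullet> b = 0" if "a \<in> V" "b \<in> B" for a b using that B(1) by (auto simp: V_def W_def)
      have VV: "a \<bullet> b = 0" if "a \<in> V" "b \<in> V" "a \<noteq> b" for a b using that v by (auto simp: V_def)
      have BB: "a \<bullet> b = 0" if "a \<in> B" "b \<in> B" "a \<noteq> b" for a b 
        using that B(3) by (auto simp: orthonormal_def pairwise_def orthogonal_def)
      show "x \<bullet> y = 0" using xy VB VV BB by (metis UnE inner_commute)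
    qed
    moreover have "norm b = 1" if "b \<in> F" for b
      using that B(3) v by (auto simp: F_def V_def orthonormal_def norm_eq_1)
    ultimately show ?thesis by (simp add: orthonormal_def)
  qed
  have Fs: "span F = UNIV"
  proof -
    have "z \<in> span F" for z
    proof -
      define p where "p = (\<Sum>i\<in>{1..k}. (v i \<bullet> z) *\<^sub>R v i)"
      have "p \<in> span F" unfolding p_def
        by (intro span_sum span_scale span_base) (auto simp: F_def V_def)
      moreover have "z - p \<in> W"
      proof -
        have "v i \<bullet> p = v i \<bullet> z" if "i \<in> {1..k}" for i
        proof -
          have "v i \<bullet> p = (\<Sum>j\<in>{1..k}. (v j \<bullet> z) * (if i = j then 1 else 0))"
            unfolding p_def inner_sum_right
            by (intro sum.cong refl) (simp only: inner_scaleR_right v[OF that])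
          also have "\<dots> = v i \<bullet> z" using that by (simp add: if_distrib[of "\<lambda>c. _ * c"] cong: if_cong)
          finally show ?thesis .
        qed
        thus ?thesis by (simp add: W_def inner_diff_right)
      qed
      hence "z - p \<in> span F" using B(4) span_mono[of B F] by (auto simp: F_def)
      ultimately have "p + (z - p) \<in> span F" by (rule span_add)
      thus ?thesis by simp
    qed
    thus ?thesis by auto
  qed
  \<comment> \<open>The Rayleigh quotient names the eigenvalue of every basis vector, prescribed or new, uniformly.\<close>
  define mu where "mu = (\<lambda>b. b \<bullet> (A *v b))"
  have muV: "mu (v i) = eigenval A i" if "i \<in> {1..k}" for i
    using that by (simp add: mu_def Av v)
  have muB: "mu b = lam b" if "b \<in> B" for b
    using that by (simp add: mu_def B(5) orthonormal_inner_self[OF B(3)])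
  have muF: "A *v b = mu b *\<^sub>R b" if "b \<in> F" for b
    using that muV muB B(5) Av by (auto simp: F_def V_def)
  have mu0: "0 \<le> mu b" for b using psd_operator_nonneg[OF pos] by (simp add: mu_def)
  define xs where "xs = rev (sorted_list_of_multiset (proots (charpoly A)))"
  have eig: "eigenval A j = (if 1 \<le> j \<and> j \<le> length xs then xs ! (j - 1) else 0)" for j
    by (simp add: eigenval_def xs_def Let_def)
  have xs: "mset xs = image_mset mu (mset_set F)"
    using proots_charpoly_eigenbasis[OF Fo F Fs muF] by (simp add: xs_def)
  have desc: "xs ! j \<le> xs ! i" if "i \<le> j" "j < length xs" for i j
    using that by (intro sorted_rev_nth_mono) (auto simp: xs_def)
  have cardV: "card V = k" unfolding V_def by (subst card_image[OF inj]) simp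
  have "length xs = card F" using arg_cong[OF xs, of size] by simp
  hence len: "length xs = k + card B" 
    using card_Un_disjoint[of V B] disj B(2) cardV by (simp add: F_def V_def)
  have "mset (take k xs) = image_mset mu (mset_set V)"
  proof -
    have "take k xs = map (eigenval A) [1..<Suc k]"
      by (rule nth_equalityI) (auto simp: len eig simp del: upt_Suc)
    hence "mset (take k xs) = image_mset (eigenval A) (mset_set {1..<Suc k})"
      by (simp only: mset_map mset_upt)
    also have "\<dots> = image_mset (mu \<circ> v) (mset_set {1..k})"
      unfolding atLeastLessThanSuc_atLeastAtMost by (intro image_mset_cong) (simp add: muV)
    also have "\<dots> = image_mset mu (mset_set V)"
      unfolding V_def image_mset_mset_set[OF inj, symmetric] by (simp only: multiset.map_comp)
    finally show ?thesis .
  qed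
  moreover have "mset xs = mset (take k xs) + mset (drop k xs)"
    by (metis append_take_drop_id mset_append)
  moreover have "mset xs = image_mset mu (mset_set V) + image_mset mu (mset_set B)"
    unfolding xs F_def using mset_set_Union[of V B] disj B(2) by (simp add: V_def)
  ultimately have drop: "mset (drop k xs) = image_mset mu (mset_set B)" by simp
  have muB_le: "mu b \<le> eigenval A (k + 1)" if "b \<in> B" for b
  proof -
    have "mu b \<in> set_mset (mset (drop k xs))" unfolding drop using that B(2) by simp
    then obtain i where i: "i < length xs - k" "mu b = xs ! (k + i)"
      by (auto simp: in_set_conv_nth)
    have "xs ! (k + i) \<le> xs ! k" using i by (intro desc) auto
    moreover have "Suc k \<le> length xs" using i by linarith
    ultimately show ?thesis using i by (simp add: eig)
  qed
  show e0: "0 \<le> eigenval A (k + 1)"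
  proof (cases "k < length xs")
    case True
    have "xs ! k \<in> set_mset (mset xs)" using True by simp
    also have "\<dots> = mu ` F" unfolding xs using F by simp
    finally show ?thesis using mu0 True by (auto simp: eig)
  qed (simp add: eig)
  show "z \<bullet> (A *v z) \<le> eigenval A (k + 1) * (z \<bullet> z)" if z: "\<And>w. w \<in> S \<Longrightarrow> w \<bullet> z = 0"
  proof -
    have "z \<bullet> (A *v z) = (\<Sum>b\<in>F. (z \<bullet> b)\<^sup>2 * mu b)"
      using inner_eigenbasis[OF sa Fo F Fs muF, of z 1] by simp
    also have "\<dots> \<le> (\<Sum>b\<in>F. (z \<bullet> b)\<^sup>2 * eigenval A (k + 1))"
    proof (rule sum_mono)
      fix b assume "b \<in> F"
      moreover have "z \<bullet> b = 0" if "b \<in> V" 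
        using z[of b] that S by (simp add: V_def span_base inner_commute)
      ultimately show "(z \<bullet> b)\<^sup>2 * mu b \<le> (z \<bullet> b)\<^sup>2 * eigenval A (k + 1)"
        using muB_le by (cases "b \<in> V") (auto simp: F_def intro!: mult_left_mono)
    qed
    also have "\<dots> = eigenval A (k + 1) * (z \<bullet> z)"
      unfolding sum_distrib_right[symmetric] using orthonormal_inner[OF Fo F Fs, of z z] 
      by (simp add: power2_eq_square)
    finally show ?thesis .
  qed
qed

section \<open>The pseudoinverse of a symmetric matrix\<close>

text \<open>
  \<open>A X\<close> and \<open>A Y\<close> are orthogonal projections with the same range, hence equal, and likewise
  \<open>X A\<close> and \<open>Y A\<close>.
\<close>

lemma penrose_unique:
  fixes A :: "real^'n^'m"
  assumes X: "A ** X ** A = A" "X ** A ** X = X" "transpose (A ** X) = A ** X" "transpose (X ** A) = X ** A"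
    and Y: "A ** Y ** A = A" "Y ** A ** Y = Y" "transpose (A ** Y) = A ** Y" "transpose (Y ** A) = Y ** A"
  shows "X = Y"
proof -
  have "A ** X = (A ** Y) ** (A ** X)" by (metis Y(1) matrix_mul_assoc)
  also have "\<dots> = transpose ((A ** X) ** (A ** Y))" by (subst matrix_transpose_mul) (simp only: X(3) Y(3))
  also have "(A ** X) ** (A ** Y) = A ** Y" by (metis X(1) matrix_mul_assoc)
  finally have AX: "A ** X = A ** Y" by (simp only: Y(3))
  have "X ** A = (X ** A) ** (Y ** A)" by (metis Y(1) matrix_mul_assoc)
  also have "\<dots> = transpose ((Y ** A) ** (X ** A))" by (subst matrix_transpose_mul) (simp only: X(4) Y(4))
  also have "(Y ** A) ** (X ** A) = Y ** A" by (metis X(1) matrix_mul_assoc)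
  finally have XA: "X ** A = Y ** A" by (simp only: Y(4))
  have "X = X ** A ** Y" by (metis X(2) AX matrix_mul_assoc)
  also have "\<dots> = Y" by (simp only: XA Y(2))
  finally show ?thesis .
qed

text \<open>
  The pseudoinverse acts on an eigenbasis of \<open>W\<close> by inverting the nonzero eigenvalues; the convention
  \<open>inverse 0 = 0\<close> covers the kernel. Hence it is symmetric and commutes with \<open>W\<close>.
\<close>

lemma pinv_symmetric:
  fixes W :: "real^'n^'n"
  assumes W: "transpose W = W"
  shows "W ** pinv W ** W = W" "pinv W ** W ** pinv W = pinv W" 
    "transpose (pinv W) = pinv W" "pinv W ** W = W ** pinv W"
proof -
  have sa: "selfadjoint ((*v) W)" using W by (simp add: selfadjoint_matrix_iff)
  obtain B lam where B: "finite B" "orthonormal B" "span B = UNIV" "\<And>b. b \<in> B \<Longrightarrow> W *v b = lam b *\<^sub>R b"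
    using spectral_theorem[OF sa] by blast
  define g where "g = (\<lambda>x. \<Sum>b\<in>B. inverse (lam b) *\<^sub>R rank_one b x)"
  have g: "selfadjoint g" unfolding g_def
    by (intro selfadjoint_sum selfadjoint_scale selfadjoint_rank_one)
  have gb: "g b = inverse (lam b) *\<^sub>R b" if "b \<in> B" for b
  proof -
    have "g b = (\<Sum>e\<in>B. if e = b then inverse (lam b) *\<^sub>R b else 0)"
      unfolding g_def
    proof (intro sum.cong refl)
      fix e assume e: "e \<in> B"
      show "inverse (lam e) *\<^sub>R rank_one e b = (if e = b then inverse (lam b) *\<^sub>R b else 0)"
        using B(2) e that orthonormal_inner_self[OF B(2) that]
        by (auto simp: orthonormal_def pairwise_def orthogonal_def rank_one_def)
    qed
    thus ?thesis using that B(1) by simp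
  qed
  define X where "X = matrix g"
  have Xg: "X *v x = g x" for x unfolding X_def using matrix_vector_mul(2)[OF selfadjoint_linear[OF g]] by metis
  have Xt: "transpose X = X" using g by (simp add: selfadjoint_matrix_iff[symmetric] Xg[abs_def])
  have eqI: "M = N" if "\<And>b. b \<in> B \<Longrightarrow> M *v b = N *v b" for M N :: "real^'n^'n"
  proof -
    have "M *v x = N *v x" for x
      using linear_eq_on_span[of "(*v) M" "(*v) N" B x] that B(3) by auto
    thus ?thesis by (simp add: matrix_eq)
  qed
  have comm: "X ** W = W ** X"
    by (rule eqI) (simp add: matrix_vector_mul_assoc[symmetric] B(4) Xg gb 
        matrix_vector_mult_scaleR linear_scale[OF selfadjoint_linear[OF g]])
  have X1: "W ** X ** W = W"
    by (rule eqI) (auto simp add: matrix_vector_mul_assoc[symmetric] B(4) Xg gb 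
        matrix_vector_mult_scaleR linear_scale[OF selfadjoint_linear[OF g]])
  have X2: "X ** W ** X = X"
    by (rule eqI) (auto simp add: matrix_vector_mul_assoc[symmetric] B(4) Xg gb 
        matrix_vector_mult_scaleR linear_scale[OF selfadjoint_linear[OF g]])
  have X3: "transpose (W ** X) = W ** X" "transpose (X ** W) = X ** W"
    by (simp_all add: matrix_transpose_mul Xt W comm)
  have "pinv W = X" unfolding pinv_def
  proof (rule the_equality)
    show "W ** X ** W = W \<and> X ** W ** X = X \<and> transpose (W ** X) = W ** X \<and> transpose (X ** W) = X ** W"
      using X1 X2 X3 by simp
  next
    fix Y assume "W ** Y ** W = W \<and> Y ** W ** Y = Y \<and> transpose (W ** Y) = W ** Y \<and> transpose (Y ** W) = Y ** W"
    thus "Y = X" using penrose_unique[of W Y X] X1 X2 X3 by blast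
  qed
  with X1 X2 Xt comm show "W ** pinv W ** W = W" "pinv W ** W ** pinv W = pinv W" 
    "transpose (pinv W) = pinv W" "pinv W ** W = W ** pinv W" by simp_all
qed

section \<open>The residual of the Nystrom extension\<close>

definition selection_matrix :: "('l::finite \<Rightarrow> 'n) \<Rightarrow> real^'l^'n" where
  "selection_matrix s = (\<chi> i j. if i = s j then 1 else 0)"

lemma column_submatrix_eq: "column_submatrix A s = A ** selection_matrix s"
  by (simp add: vec_eq_iff column_submatrix_def selection_matrix_def matrix_matrix_mult_def
      if_distrib[of "\<lambda>c. _ * c"] cong: if_cong)

lemma principal_submatrix_eq: 
  "principal_submatrix A s = transpose (selection_matrix s) ** A ** selection_matrix s"
  by (simp add: vec_eq_iff principal_submatrix_def selection_matrix_def matrix_matrix_mult_def transpose_def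
      if_distrib[of "\<lambda>c. _ * c"] if_distrib[of "\<lambda>c. c * _"] cong: if_cong)

lemma transpose_selection_matrix_nth: "(transpose (selection_matrix s) *v x) $ j = x $ s j"
  by (simp add: selection_matrix_def matrix_vector_mult_def transpose_def
      if_distrib[of "\<lambda>c. c * _"] cong: if_cong)

lemma selection_matrix_inner_self:
  assumes "inj s"
  shows "(selection_matrix s *v y) \<bullet> (selection_matrix s *v y) = y \<bullet> y"
proof -
  have "(selection_matrix s *v y) $ s j = y $ j" for j
    using assms by (simp add: selection_matrix_def matrix_vector_mult_def inj_eq
      if_distrib[of "\<lambda>c. c * _"] cong: if_cong)
  hence "transpose (selection_matrix s) *v (selection_matrix s *v y) = y"
    by (simp add: vec_eq_iff transpose_selection_matrix_nth)
  thus ?thesis by (simp only: matrix_inner_transpose)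
qed

text \<open>
  The residual is a generalised Schur complement: its form at \<open>x\<close> is the minimum over \<open>y\<close> of the
  form of \<open>A\<close> at \<open>x - S y\<close>. Completing the square yields this once \<open>b = S\<^sup>t A x\<close> is known to be in the
  range of \<open>W = S\<^sup>t A S\<close>, that is \<open>W W\<^sup>\<dagger> b = b\<close>; a null vector \<open>w\<close> of \<open>W\<close> satisfies
  \<open>A S w = 0\<close> by positivity and is therefore orthogonal to \<open>b\<close>.
\<close>

lemma nystrom_residual_form:
  fixes A :: "real^'n^'n" and s :: "'l::finite \<Rightarrow> 'n"
  assumes A: "psd_matrix A"
  defines "E \<equiv> A - nystrom A s" and "S \<equiv> selection_matrix s"
  shows "psd_matrix E" and "x \<bullet> (E *v x) \<le> (x - S *v y) \<bullet> (A *v (x - S *v y))"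
proof -
  have pos: "psd_operator ((*v) A)" using A by (simp add: psd_operator_matrix_iff)
  note sa = psd_operator_selfadjoint[OF pos]
  have At: "transpose A = A" using A by (simp add: psd_matrix_def)
  define W where "W = transpose S ** A ** S"
  have Wt: "transpose W = W" by (simp add: W_def matrix_transpose_mul At matrix_mul_assoc)
  define X where "X = pinv W"
  note X = pinv_symmetric[OF Wt, folded X_def]
  have E: "E = A - A ** S ** X ** transpose S ** A"
    by (simp add: E_def nystrom_def column_submatrix_eq principal_submatrix_eq S_def[symmetric] W_def[symmetric]
        X_def matrix_transpose_mul At matrix_mul_assoc)
  have Et: "transpose E = E"
  proof -
    have "transpose (A ** S ** X ** transpose S ** A) = A ** S ** X ** transpose S ** A"
      by (simp add: matrix_transpose_mul At X(3) matrix_mul_assoc)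
    thus ?thesis using At unfolding E by (simp add: vec_eq_iff transpose_def)
  qed
  have Spos: "W *v y = transpose S *v (A *v (S *v y))" for y
    by (simp add: W_def matrix_vector_mul_assoc matrix_mul_assoc)
  have kernel: "W *v (X *v (transpose S *v (A *v x))) = transpose S *v (A *v x)" for x
  proof -
    \<comment> \<open>The component of \<open>S\<^sup>t A x\<close> in the kernel of \<open>W\<close>, up to sign; it is shown to be zero.\<close>
    define w where "w = (W ** X) *v (transpose S *v (A *v x)) - transpose S *v (A *v x)"
    have "W *v w = 0"
      using X(1) unfolding w_def by (metis X(4) diff_self matrix_mul_assoc matrix_vector_mul_assoc matrix_vector_mult_diff_distrib)
    hence "(S *v w) \<bullet> (A *v (S *v w)) = 0"
      using matrix_inner_transpose[of w "transpose S" "A *v (S *v w)"] by (simp add: Spos)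
    hence "A *v (S *v w) = 0" by (rule psd_operator_quadratic_form_zero[OF pos])
    hence "w \<bullet> (transpose S *v (A *v x)) = 0"
      by (simp add: matrix_inner_transpose At)
    moreover have "w \<bullet> ((W ** X) *v (transpose S *v (A *v x))) = 0"
    proof -
      have "w \<bullet> (W *v (X *v (transpose S *v (A *v x)))) = (W *v w) \<bullet> (X *v (transpose S *v (A *v x)))"
        by (simp only: matrix_inner_transpose[of w W] Wt)
      thus ?thesis using \<open>W *v w = 0\<close> by (simp add: matrix_vector_mul_assoc matrix_mul_assoc)
    qed
    ultimately have "w \<bullet> w = 0" by (simp add: w_def inner_diff_right)
    thus ?thesis by (simp add: w_def matrix_vector_mul_assoc matrix_mul_assoc)
  qed
  have form: "(x - S *v y) \<bullet> (A *v (x - S *v y)) 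
      = x \<bullet> (E *v x) + (y - X *v (transpose S *v (A *v x))) \<bullet> (W *v (y - X *v (transpose S *v (A *v x))))" for x y
  proof -
    define b where "b = transpose S *v (A *v x)"
    have xE: "x \<bullet> (E *v x) = x \<bullet> (A *v x) - b \<bullet> (X *v b)"
    proof -
      have "(A ** S ** X ** transpose S ** A) *v x = A *v (S *v (X *v b))"
        by (simp add: b_def matrix_vector_mul_assoc matrix_mul_assoc)
      moreover have "x \<bullet> (A *v (S *v (X *v b))) = b \<bullet> (X *v b)"
        by (simp add: b_def matrix_inner_transpose At)
      ultimately show ?thesis by (simp add: E matrix_vector_mult_diff_rdistrib inner_diff_right)
    qed
    have xSy: "x \<bullet> (A *v (S *v y)) = b \<bullet> y" by (simp add: b_def matrix_inner_transpose At)
    have Syx: "(S *v y) \<bullet> (A *v x) = b \<bullet> y" using xSy selfadjoint_inner[OF sa] by (metis inner_commute)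
    have SySy: "(S *v y) \<bullet> (A *v (S *v y)) = y \<bullet> (W *v y)"
      by (simp add: Spos matrix_inner_transpose[of y "transpose S"])
    have WXb: "W *v (X *v b) = b" using kernel by (simp add: b_def)
    have XbWy: "(X *v b) \<bullet> (W *v y) = b \<bullet> y"
      by (metis WXb Wt matrix_inner_transpose)
    have "(x - S *v y) \<bullet> (A *v (x - S *v y)) = x \<bullet> (A *v x) - 2 * (b \<bullet> y) + y \<bullet> (W *v y)"
      by (simp add: matrix_vector_mult_diff_distrib inner_diff_left inner_diff_right xSy Syx SySy)
    moreover have "(y - X *v b) \<bullet> (W *v (y - X *v b)) = y \<bullet> (W *v y) - 2 * (b \<bullet> y) + b \<bullet> (X *v b)"
      by (simp add: matrix_vector_mult_diff_distrib inner_diff_left inner_diff_right XbWy WXb inner_commute[of y b]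
          inner_commute[of "X *v b" b])
    ultimately show ?thesis using xE by (simp add: b_def)
  qed
  have Wpos: "0 \<le> y \<bullet> (W *v y)" for y
    using psd_operator_nonneg[OF pos, of "S *v y"] by (simp add: Spos matrix_inner_transpose[of y "transpose S"])
  show "x \<bullet> (E *v x) \<le> (x - S *v y) \<bullet> (A *v (x - S *v y))" 
    using form[of x y] Wpos[of "y - X *v (transpose S *v (A *v x))"] by simp
  have "0 \<le> x \<bullet> (E *v x)" for x
    using form[of x "X *v (transpose S *v (A *v x))"] 
      psd_operator_nonneg[OF pos, of "x - S *v (X *v (transpose S *v (A *v x)))"] by simp
  thus "psd_matrix E" using Et by (simp add: psd_matrix_def)
qed

text \<open>
  Cauchy--Schwarz for the form of \<open>E\<close>, applied to \<open>x\<close> and \<open>E x\<close>, bounds the norm by the form.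
\<close>

lemma spectral_norm_psd_le:
  assumes E: "psd_matrix E" and K: "0 \<le> K" "\<And>x. x \<bullet> (E *v x) \<le> K * (x \<bullet> x)"
  shows "spectral_norm E \<le> K"
  unfolding spectral_norm_def
proof (rule onorm_le)
  fix x
  have pos: "psd_operator ((*v) E)" using E by (simp add: psd_operator_matrix_iff)
  define y where "y = E *v x"
  have "(y \<bullet> y)\<^sup>2 \<le> (y \<bullet> (E *v y)) * (x \<bullet> (E *v x))"
    using psd_operator_cauchy_schwarz[OF pos, of y x] by (simp add: y_def)
  also have "\<dots> \<le> (K * (y \<bullet> y)) * (K * (x \<bullet> x))"
    using K psd_operator_nonneg[OF pos] by (intro mult_mono) auto
  finally have "(norm y)\<^sup>2 * (norm y)\<^sup>2 \<le> (norm y)\<^sup>2 * (K * norm x)\<^sup>2"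
    by (simp add: dot_square_norm power2_eq_square mult_ac)
  note le = this
  have "norm y \<le> K * norm x"
  proof (cases "y = 0")
    case False
    have sq: "(norm y)\<^sup>2 \<le> (K * norm x)\<^sup>2"
      using le by (rule mult_left_le_imp_le) (use False in simp)
    show ?thesis by (rule power2_le_imp_le[OF sq]) (use K in simp)
  qed (use K in simp)
  thus "norm (E *v x) \<le> K * norm x" by (simp add: y_def)
qed

text \<open>
  The minimal-norm solution \<open>y\<close> of \<open>U\<^sup>t S y = U\<^sup>t x\<close> has squared norm at most \<open>1 / \<beta>\<close> times that of
  \<open>U\<^sup>t x\<close>, because \<open>\<beta>\<close> bounds the eigenvalues of \<open>(U\<^sup>t S) (U\<^sup>t S)\<^sup>t\<close> from below. Then \<open>x - S y\<close> is the
  difference of the components \<open>p\<close> of \<open>x\<close> and \<open>q\<close> of \<open>S y\<close> that are orthogonal to the columns of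
  \<open>U\<close>, and Pythagoras bounds \<open>q \<bullet> q\<close> by \<open>y \<bullet> y\<close>.
\<close>

lemma interpolation_from_sample:
  fixes U :: "real^'k^'n" and s :: "'l::finite \<Rightarrow> 'n"
  assumes U: "orthonormal_columns U" and s: "inj s" and \<beta>: "0 < \<beta>"
    and low: "\<And>x. \<beta> * (x \<bullet> x) \<le> (\<Sum>j\<in>UNIV. (U $ s j \<bullet> x)\<^sup>2)"
  obtains y where "transpose U *v (x - selection_matrix s *v y) = 0"
    and "(x - selection_matrix s *v y) \<bullet> (x - selection_matrix s *v y) \<le> (1 + 1 / \<beta>) * (x \<bullet> x)"
proof -
  let ?S = "selection_matrix s"
  have UU: "transpose U *v (U *v a) = a" for a
    using U by (simp add: orthonormal_columns_def matrix_vector_mul_assoc)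
  define T where "T = transpose U ** ?S"
  define M where "M = T ** transpose T"
  have Tt: "transpose T *v b = transpose ?S *v (U *v b)" for b
    by (simp add: T_def matrix_transpose_mul matrix_vector_mul_assoc)
  have bM: "b \<bullet> (M *v b) = (transpose T *v b) \<bullet> (transpose T *v b)" for b
    by (simp add: M_def matrix_vector_mul_assoc[symmetric] matrix_inner_transpose[of b T])
  have Mlow: "\<beta> * (b \<bullet> b) \<le> b \<bullet> (M *v b)" for b
  proof -
    have "b \<bullet> (M *v b) = (\<Sum>j\<in>UNIV. (U $ s j \<bullet> b)\<^sup>2)"
    proof -
      have sq: "w \<bullet> w = (\<Sum>j\<in>UNIV. (w $ j)\<^sup>2)" for w :: "real^'l"
        by (simp add: inner_vec_def power2_eq_square)
      show ?thesis unfolding bM Tt sq transpose_selection_matrix_nth by (simp only: matrix_vector_mul_component)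
    qed
    thus ?thesis using low[of b] by simp
  qed
  have "inj ((*v) M)"
  proof (subst linear_injective_0)
    show "\<forall>b. M *v b = 0 \<longrightarrow> b = 0"
    proof (intro allI impI)
      fix b assume "M *v b = 0"
      with Mlow[of b] \<beta> have "b \<bullet> b \<le> 0" by (simp add: mult_le_0_iff)
      thus "b = 0" by (metis inner_ge_zero inner_eq_zero_iff order_antisym)
    qed
  qed simp
  hence "surj ((*v) M)" by (intro linear_injective_imp_surjective) auto
  define a where "a = transpose U *v x"
  obtain b where b: "M *v b = a" using \<open>surj ((*v) M)\<close> by (metis surjD)
  define y where "y = transpose T *v b"
  have yy: "y \<bullet> y \<le> (a \<bullet> a) / \<beta>"
  proof -
    have yb: "y \<bullet> y = b \<bullet> a" using bM[of b] by (simp add: y_def b)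
    have "(b \<bullet> a)\<^sup>2 \<le> (b \<bullet> b) * (a \<bullet> a)" by (rule Cauchy_Schwarz_ineq)
    also have "\<dots> \<le> ((b \<bullet> a) / \<beta>) * (a \<bullet> a)"
      using Mlow[of b] \<beta> by (intro mult_right_mono) (auto simp: b field_simps)
    finally have "(b \<bullet> a) * (b \<bullet> a) \<le> (b \<bullet> a) * ((a \<bullet> a) / \<beta>)" by (simp add: power2_eq_square)
    moreover have "0 \<le> b \<bullet> a" using yb inner_ge_zero by metis
    moreover have "0 \<le> (a \<bullet> a) / \<beta>" using \<beta> by simp
    ultimately have "b \<bullet> a \<le> (a \<bullet> a) / \<beta>" by (metis mult_left_le_imp_le order_le_less)
    thus ?thesis by (simp only: yb)
  qed
  have UtSy: "transpose U *v (?S *v y) = a"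
    using b by (simp add: y_def M_def T_def matrix_vector_mul_assoc matrix_mul_assoc)
  define p where "p = x - U *v a"
  define q where "q = ?S *v y - U *v a"
  have Up: "transpose U *v p = 0" and Uq: "transpose U *v q = 0"
    by (simp_all add: p_def q_def matrix_vector_mult_diff_distrib UU a_def[symmetric] UtSy)
  have pyth: "(U *v c + z) \<bullet> (U *v c + z) = c \<bullet> c + z \<bullet> z" if "transpose U *v z = 0" for c z
  proof -
    have "z \<bullet> (U *v c) = 0" using that by (simp add: matrix_inner_transpose)
    moreover have "(U *v c) \<bullet> (U *v c) = c \<bullet> c" by (simp add: matrix_inner_transpose UU)
    ultimately show ?thesis by (simp add: inner_add_left inner_add_right inner_commute)
  qed
  have xx: "x \<bullet> x = a \<bullet> a + p \<bullet> p" using pyth[OF Up, of a] by (simp add: p_def)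
  have qq: "a \<bullet> a + q \<bullet> q = y \<bullet> y" 
    using pyth[OF Uq, of a] selection_matrix_inner_self[OF s, of y] by (simp add: q_def)
  show thesis
  proof (rule that)
    show "transpose U *v (x - ?S *v y) = 0"
      by (simp add: matrix_vector_mult_diff_distrib UtSy a_def)
    define r where "r = 1 / \<beta>"
    have r: "0 < r" using \<beta> by (simp add: r_def)
    have "q \<bullet> q \<le> y \<bullet> y" using qq inner_ge_zero[of a] by linarith
    hence qa: "q \<bullet> q \<le> r * (a \<bullet> a)" using yy by (simp add: r_def)
    \<comment> \<open>The arithmetic--geometric mean inequality, weighted so that the factor \<open>1 + r\<close> is met exactly.\<close>
    have "0 \<le> (r *\<^sub>R p + q) \<bullet> (r *\<^sub>R p + q)" by (rule inner_ge_zero)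
    also have "\<dots> = r * (r * (p \<bullet> p) + 2 * (p \<bullet> q)) + q \<bullet> q"
      by (simp add: inner_add_left inner_add_right inner_commute algebra_simps)
    also have "\<dots> \<le> r * (r * (p \<bullet> p) + 2 * (p \<bullet> q)) + r * (a \<bullet> a)" using qa by simp
    also have "\<dots> = r * (r * (p \<bullet> p) + 2 * (p \<bullet> q) + a \<bullet> a)" by (simp add: algebra_simps)
    finally have "0 \<le> r * (p \<bullet> p) + 2 * (p \<bullet> q) + a \<bullet> a" using r by (simp add: zero_le_mult_iff)
    moreover have "(p - q) \<bullet> (p - q) = p \<bullet> p - 2 * (p \<bullet> q) + q \<bullet> q"
      by (simp add: inner_diff_left inner_diff_right inner_commute)
    ultimately have "(p - q) \<bullet> (p - q) \<le> (1 + r) * (a \<bullet> a + p \<bullet> p)"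
      using qa by (simp add: algebra_simps)
    moreover have "x - ?S *v y = p - q" by (simp add: p_def q_def)
    ultimately show "(x - ?S *v y) \<bullet> (x - ?S *v y) \<le> (1 + 1 / \<beta>) * (x \<bullet> x)"
      by (simp add: xx r_def)
  qed
qed

text \<open>
  In \<open>nystrom_residual_form\<close> choose \<open>y\<close> so that \<open>x - S y\<close> is orthogonal to the
  dominant subspace, where the form of \<open>A\<close> is at most \<open>eigenval A (k + 1)\<close> times the squared norm.
\<close>

theorem nystrom_spectral_norm_le:
  fixes A :: "real^'n^'n" and U :: "real^'k^'n" and s :: "'l::finite \<Rightarrow> 'n"
  assumes A: "psd_matrix A" and U: "orthonormal_columns U"
    and dom: "dominant_invariant_subspace A k (span (columns U))"
    and s: "inj s" and \<beta>: "0 < \<beta>" "\<And>x. \<beta> * (x \<bullet> x) \<le> (\<Sum>j\<in>UNIV. (U $ s j \<bullet> x)\<^sup>2)"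
  shows "spectral_norm (A - nystrom A s) \<le> eigenval A (k + 1) * (1 + 1 / \<beta>)"
proof (rule spectral_norm_psd_le[OF nystrom_residual_form(1)[OF A]])
  note e0 = dominant_complement_form_le(1)[OF A dom]
  show "0 \<le> eigenval A (k + 1) * (1 + 1 / \<beta>)" using e0 \<beta>(1) by simp
  fix x
  obtain y where y: "transpose U *v (x - selection_matrix s *v y) = 0"
    "(x - selection_matrix s *v y) \<bullet> (x - selection_matrix s *v y) \<le> (1 + 1 / \<beta>) * (x \<bullet> x)"
    using interpolation_from_sample[OF U s \<beta>] by blast
  define z where "z = x - selection_matrix s *v y"
  have "w \<bullet> z = 0" if "w \<in> span (columns U)" for w
  proof -
    have "orthogonal z c" if c: "c \<in> columns U" for c
    proof -
      obtain j where "c = column j U" using c by (auto simp: columns_def)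
      moreover have "(transpose U *v z) $ j = 0" using y(1) by (simp add: z_def)
      ultimately show ?thesis 
        by (simp add: orthogonal_def inner_vec_def matrix_vector_mult_def transpose_def column_def mult.commute)
    qed
    hence "orthogonal z w" by (rule orthogonal_to_span[OF that])
    thus ?thesis by (simp add: orthogonal_def inner_commute)
  qed
  from dominant_complement_form_le(2)[OF A dom this] 
  have "z \<bullet> (A *v z) \<le> eigenval A (k + 1) * (z \<bullet> z)" .
  also have "\<dots> \<le> eigenval A (k + 1) * ((1 + 1 / \<beta>) * (x \<bullet> x))"
    using y(2) e0 by (intro mult_left_mono) (auto simp: z_def)
  finally show "x \<bullet> ((A - nystrom A s) *v x) \<le> eigenval A (k + 1) * (1 + 1 / \<beta>) * (x \<bullet> x)"
    using nystrom_residual_form(2)[OF A, of x s y] by (simp add: z_def mult.assoc)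
qed


section \<open>The failure probability\<close>

text \<open>
  The right-hand side minus the left-hand side vanishes at \<open>1\<close> and has derivative \<open>ln x + 1 - x < 0\<close> before.
  The strictness makes the failure probability in the theorem strictly smaller than \<open>\<delta>\<close>.
\<close>

lemma chernoff_exponent_gt:
  fixes x :: real
  assumes "0 < x" "x < 1"
  shows "(1 - x)\<^sup>2 / 2 < 1 - x + x * ln x"
proof -
  define g where "g = (\<lambda>x::real. 1 - x + x * ln x - (1 - x)\<^sup>2 / 2)"
  have "g 1 < g x"
  proof (rule DERIV_neg_imp_decreasing_open[OF assms(2)])
    fix t assume t: "x < t" "t < 1"
    hence "0 < t" using assms by simp
    have "(g has_real_derivative (ln t + 1 - t)) (at t)" unfolding g_def
      using \<open>0 < t\<close> by (auto intro!: derivative_eq_intros simp: field_simps)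
    moreover have "ln t + 1 - t < 0"
      using ln_le_minus_one[OF \<open>0 < t\<close>] ln_eq_minus_one[OF \<open>0 < t\<close>] t by force
    ultimately show "\<exists>y. (g has_real_derivative y) (at t) \<and> y < 0" by blast
  next
    show "continuous_on {x..1} g" unfolding g_def using assms by (intro continuous_intros) auto
  qed
  thus ?thesis by (simp add: g_def)
qed

text \<open>
  The choice \<open>\<theta> = - ln \<epsilon> / B\<close> optimises the Chernoff bound at \<open>t = \<epsilon> l / n\<close>; the exponent becomes
  \<open>- l / (n B)\<close> times \<open>1 - \<epsilon> + \<epsilon> ln \<epsilon>\<close>.
\<close>

corollary card_small_sampled_frame_less:
  fixes u :: "'n::finite \<Rightarrow> 'a::euclidean_space"
  assumes card: "CARD('l::finite) \<le> CARD('n)"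
    and u: "parseval_frame u" and B: "\<And>i. u i \<bullet> u i \<le> B" and \<epsilon>: "0 < \<epsilon>" "\<epsilon> < 1"
  shows "0 < B" and "real (card {s :: 'l \<Rightarrow> 'n. inj s \<and> (\<exists>x. x \<bullet> x = 1 \<and>
            (\<Sum>j\<in>UNIV. (u (s j) \<bullet> x)\<^sup>2) < \<epsilon> * real CARD('l) / real CARD('n))})
      < real (card {s :: 'l \<Rightarrow> 'n. inj s}) * (real DIM('a) 
          * exp (- ((1 - \<epsilon>)\<^sup>2 * real CARD('l) / (2 * (real CARD('n) * B)))))"
proof -
  define n l where "n = real CARD('n)" and "l = CARD('l)"
  have n: "0 < n" and l: "0 < l" by (simp_all add: n_def l_def)
  have "real DIM('a) = (\<Sum>i\<in>UNIV. u i \<bullet> u i)"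
    using parseval_frame_optrace[OF u selfadjoint_scale_id[of 1]] by (simp add: optrace_def)
  also have "\<dots> \<le> n * B" using sum_mono[of UNIV "\<lambda>i. u i \<bullet> u i" "\<lambda>_. B"] B by (simp add: n_def)
  finally have nB: "1 \<le> n * B" using DIM_positive[where 'a='a] by linarith
  show B0: "0 < B" using nB n by (smt (verit) mult_nonneg_nonpos)
  define \<theta> where "\<theta> = - ln \<epsilon> / B"
  have \<theta>: "0 < \<theta>" using \<epsilon> B0 by (simp add: \<theta>_def divide_neg_pos)
  have e: "exp (- (\<theta> * B)) = \<epsilon>" using \<epsilon> B0 by (simp add: \<theta>_def)
  have "{s :: 'l \<Rightarrow> 'n. inj s} \<noteq> {}"
    using card by (metis (mono_tags, lifting) card_le_inj[of "UNIV :: 'l set" "UNIV :: 'n set"] empty_Collect_eq finite)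
  hence I: "0 < real (card {s :: 'l \<Rightarrow> 'n. inj s})" by (simp add: card_gt_0_iff)
  have "exp (\<theta> * (\<epsilon> * real l / n)) * (1 - (1 - \<epsilon>) / (n * B)) ^ l 
      \<le> exp (\<theta> * (\<epsilon> * real l / n)) * exp (- ((1 - \<epsilon>) / (n * B))) ^ l"
  proof (intro mult_left_mono power_mono)
    show "1 - (1 - \<epsilon>) / (n * B) \<le> exp (- ((1 - \<epsilon>) / (n * B)))"
      using exp_ge_add_one_self[of "- ((1 - \<epsilon>) / (n * B))"] by simp
    show "0 \<le> 1 - (1 - \<epsilon>) / (n * B)" using nB \<epsilon> by simp
  qed simp
  also have "\<dots> = exp (\<theta> * (\<epsilon> * real l / n) + real l * (- ((1 - \<epsilon>) / (n * B))))"
    by (simp only: exp_add exp_of_nat_mult)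
  also have "\<theta> * (\<epsilon> * real l / n) + real l * (- ((1 - \<epsilon>) / (n * B))) 
      = - (real l / (n * B) * (1 - \<epsilon> + \<epsilon> * ln \<epsilon>))"
    using n B0 by (simp add: \<theta>_def field_simps)
  also have "exp \<dots> < exp (- (real l / (n * B) * ((1 - \<epsilon>)\<^sup>2 / 2)))"
  proof -
    have "0 < real l / (n * B)" using l n B0 by simp
    hence "real l / (n * B) * ((1 - \<epsilon>)\<^sup>2 / 2) < real l / (n * B) * (1 - \<epsilon> + \<epsilon> * ln \<epsilon>)"
      by (intro mult_strict_left_mono chernoff_exponent_gt[OF \<epsilon>])
    thus ?thesis by (simp only: exp_less_cancel_iff neg_less_iff_less)
  qed
  finally have lt: "exp (\<theta> * (\<epsilon> * real l / n)) * (1 - (1 - \<epsilon>) / (n * B)) ^ l 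
      < exp (- (real l / (n * B) * ((1 - \<epsilon>)\<^sup>2 / 2)))" .
  have "real (card {s :: 'l \<Rightarrow> 'n. inj s \<and> (\<exists>x. x \<bullet> x = 1 \<and> (\<Sum>j\<in>UNIV. (u (s j) \<bullet> x)\<^sup>2) < \<epsilon> * real l / n)})
     \<le> real (card {s :: 'l \<Rightarrow> 'n. inj s}) * (real DIM('a) * (exp (\<theta> * (\<epsilon> * real l / n)) * (1 - (1 - \<epsilon>) / (n * B)) ^ l))"
    using matrix_chernoff_rank_one_without_replacement[OF card u B B0 \<theta>, of "\<epsilon> * real l / n"]
    by (simp add: e n_def l_def mult.assoc)
  also have "\<dots> < real (card {s :: 'l \<Rightarrow> 'n. inj s}) * (real DIM('a) * exp (- (real l / (n * B) * ((1 - \<epsilon>)\<^sup>2 / 2))))"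
    using lt I by (intro mult_strict_left_mono) auto
  finally show "real (card {s :: 'l \<Rightarrow> 'n. inj s \<and> (\<exists>x. x \<bullet> x = 1 \<and>
            (\<Sum>j\<in>UNIV. (u (s j) \<bullet> x)\<^sup>2) < \<epsilon> * real CARD('l) / real CARD('n))})
      < real (card {s :: 'l \<Rightarrow> 'n. inj s}) * (real DIM('a) 
          * exp (- ((1 - \<epsilon>)\<^sup>2 * real CARD('l) / (2 * (real CARD('n) * B)))))"
    by (simp add: n_def l_def mult_ac)
qed

lemma parseval_frame_rows:
  fixes U :: "real^'k^'n"
  assumes "orthonormal_columns U"
  shows "parseval_frame (\<lambda>i. U $ i)"
  unfolding parseval_frame_def
proof (intro allI)
  fix x y
  have "(\<Sum>i\<in>UNIV. (U $ i \<bullet> x) * (U $ i \<bullet> y)) = (U *v x) \<bullet> (U *v y)"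
    by (simp add: inner_vec_def[of "U *v x"] matrix_vector_mul_component)
  also have "\<dots> = (transpose U *v (U *v x)) \<bullet> y" by (rule matrix_inner_transpose)
  also have "\<dots> = x \<bullet> y"
    using assms by (simp add: orthonormal_columns_def matrix_vector_mul_assoc)
  finally show "(\<Sum>i\<in>UNIV. (U $ i \<bullet> x) * (U $ i \<bullet> y)) = x \<bullet> y" .
qed

theorem theorem2:
  fixes A :: "real^'n^'n"
    and U\<^sub>1 :: "real^'k^'n"
    and \<tau> \<delta> \<epsilon> :: real
  assumes "psd_matrix A"
    and "CARD('k) \<le> CARD('n)"
    and "orthonormal_columns U\<^sub>1"
    and "dominant_invariant_subspace A CARD('k) (span (columns U\<^sub>1))"
    and "\<tau> = coherence U\<^sub>1"
    and "0 < \<delta>" "\<delta> < 1"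
    and "0 < \<epsilon>" "\<epsilon> < 1"
    and "CARD('l::finite) \<le> CARD('n)"
    and "real CARD('l) \<ge> 2 * \<tau> * real CARD('k) * ln (real CARD('k) / \<delta>) / (1 - \<epsilon>)\<^sup>2"
  shows "measure_pmf.prob (uniform_without_replacement :: ('l \<Rightarrow> 'n) pmf)
           {s. spectral_norm (A - nystrom A s)
                 \<le> eigenval A (CARD('k) + 1) * (1 + real CARD('n) / (\<epsilon> * real CARD('l)))}
         > 1 - \<delta>"
proof -
  define u where "u = (\<lambda>i. U\<^sub>1 $ i)"
  define B where "B = Max (range (\<lambda>i. (U\<^sub>1 ** transpose U\<^sub>1) $ i $ i))"
  define t where "t = \<epsilon> * real CARD('l) / real CARD('n)"
  define I where "I = {s :: 'l \<Rightarrow> 'n. inj s}"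
  define bad where "bad = {s :: 'l \<Rightarrow> 'n. inj s \<and> (\<exists>x. x \<bullet> x = 1 \<and> (\<Sum>j\<in>UNIV. (u (s j) \<bullet> x)\<^sup>2) < t)}"
  define good where "good = {s :: 'l \<Rightarrow> 'n. spectral_norm (A - nystrom A s)
                 \<le> eigenval A (CARD('k) + 1) * (1 + real CARD('n) / (\<epsilon> * real CARD('l)))}"
  have t: "0 < t" using assms(8) by (simp add: t_def)
  have u: "parseval_frame u" unfolding u_def by (rule parseval_frame_rows[OF assms(3)])
  have uB: "u i \<bullet> u i \<le> B" for i
  proof -
    have "u i \<bullet> u i = (U\<^sub>1 ** transpose U\<^sub>1) $ i $ i"
      by (simp add: u_def inner_vec_def matrix_matrix_mult_def transpose_def)
    also have "\<dots> \<le> B" unfolding B_def by (intro Max_ge) auto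
    finally show ?thesis .
  qed
  note chernoff = card_small_sampled_frame_less[OF assms(10) u uB assms(8,9), folded t_def bad_def I_def]
  have tau: "\<tau> * real CARD('k) = real CARD('n) * B"
    using assms(5) by (simp add: coherence_def B_def)
  have nB: "0 < real CARD('n) * B" using chernoff(1) by simp
  have "real CARD('k) * exp (- ((1 - \<epsilon>)\<^sup>2 * real CARD('l) / (2 * (real CARD('n) * B)))) \<le> \<delta>"
  proof -
    have sq: "0 < (1 - \<epsilon>)\<^sup>2" using assms(9) by simp
    have "2 * (\<tau> * real CARD('k)) * ln (real CARD('k) / \<delta>) \<le> (1 - \<epsilon>)\<^sup>2 * real CARD('l)"
      using assms(11) sq by (simp add: pos_divide_le_eq mult_ac)
    hence "ln (real CARD('k) / \<delta>) * (2 * (real CARD('n) * B)) \<le> (1 - \<epsilon>)\<^sup>2 * real CARD('l)"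
      unfolding tau by (simp add: mult_ac)
    hence "ln (real CARD('k) / \<delta>) \<le> (1 - \<epsilon>)\<^sup>2 * real CARD('l) / (2 * (real CARD('n) * B))"
      using nB by (subst pos_le_divide_eq) auto
    hence "exp (- ((1 - \<epsilon>)\<^sup>2 * real CARD('l) / (2 * (real CARD('n) * B)))) \<le> exp (- ln (real CARD('k) / \<delta>))"
      by simp
    also have "\<dots> = \<delta> / real CARD('k)" using assms(6) by (simp add: exp_minus)
    finally show ?thesis by (simp add: field_simps)
  qed
  hence "real (card I) * (real CARD('k) * exp (- ((1 - \<epsilon>)\<^sup>2 * real CARD('l) / (2 * (real CARD('n) * B))))) \<le> real (card I) * \<delta>"
    by (intro mult_left_mono) auto
  with chernoff(2) have bad: "real (card bad) < real (card I) * \<delta>"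
    unfolding bad_def by (simp only: DIM_cart DIM_real mult_1_right)
  have I: "0 < card I" using bad by (metis gr0I mult_zero_left of_nat_0 of_nat_less_0_iff)
  hence Ine: "I \<noteq> {}" by auto
  have sub: "I - bad \<subseteq> I \<inter> good"
  proof
    fix s assume s: "s \<in> I - bad"
    hence inj: "inj s" by (simp add: I_def)
    have low: "t * (x \<bullet> x) \<le> (\<Sum>j\<in>UNIV. (U\<^sub>1 $ s j \<bullet> x)\<^sup>2)" for x
    proof (cases "x = 0")
      case False
      define y where "y = x /\<^sub>R norm x"
      have "y \<bullet> y = 1" using False by (simp add: y_def dot_square_norm)
      hence "t \<le> (\<Sum>j\<in>UNIV. (u (s j) \<bullet> y)\<^sup>2)" using s inj by (auto simp: bad_def I_def not_less)
      also have "\<dots> = (\<Sum>j\<in>UNIV. (u (s j) \<bullet> x)\<^sup>2) / (x \<bullet> x)"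
        by (simp add: y_def dot_square_norm sum_divide_distrib power_mult_distrib field_simps)
      finally show ?thesis using False by (simp add: u_def field_simps)
    qed simp
    have "spectral_norm (A - nystrom A s) \<le> eigenval A (CARD('k) + 1) * (1 + 1 / t)"
      by (rule nystrom_spectral_norm_le[OF assms(1,3,4) inj t low])
    thus "s \<in> I \<inter> good" using s by (simp add: good_def t_def)
  qed
  have "bad \<subseteq> I" by (auto simp: bad_def I_def)
  hence "real (card (I - bad)) = real (card I) - real (card bad)"
    by (subst card_Diff_subset) (auto simp: card_mono of_nat_diff)
  moreover have "card (I - bad) \<le> card (I \<inter> good)" using sub by (intro card_mono) auto
  ultimately have "real (card I) - real (card I) * \<delta> < real (card (I \<inter> good))" using bad by linarith
  hence "1 - \<delta> < real (card (I \<inter> good)) / real (card I)"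
    using I by (subst pos_less_divide_eq) (auto simp: algebra_simps)
  also have "\<dots> = measure_pmf.prob (uniform_without_replacement :: ('l \<Rightarrow> 'n) pmf) good"
    unfolding uniform_without_replacement_def I_def[symmetric] by (rule measure_pmf_of_set[OF Ine, symmetric]) simp
  finally show ?thesis unfolding good_def .
qed

end
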